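(* Fix $K\ge1$ and $\sigma>0$. Let $\mathscr{U}\subset\mathscr{M}$ be a family of tuples $\vartheta=(\{f_k\}_{k=1}^K,\{\lambda_k\}_{k=1}^K,\{\mu_k\}_{k=1}^K)$, $f_k=\phi_\sigma\ast G_k$, satisfying: (D1) $\sup_{\vartheta\in\mathscr{U}}\max_k\big[\operatorname{diam}(\operatorname{supp}(G_k))\vee|\mu_k|\big]<\infty$; (D2) $\inf_{\vartheta\in\mathscr{U}}\min_k\lambda_k>0$; (D3) $\inf_{\vartheta\in\mathscr{U}}\Big[\min_{j\ne k}\operatorname{dist}\big(\operatorname{supp}(G_j(\cdot-\mu_j)),\operatorname{supp}(G_k(\cdot-\mu_k))\big)-\max_k\operatorname{diam}(\operatorname{supp}(G_k))\Big]>0$. Then there exist estimators $\widehat\lambda_{n,k}$ and $\widehat f_{n,k}$ ($k=1,\dots,K$), based on $n$ i.i.d. samples from the density $p=\sum_{k=1}^K\lambda_kf_k(\cdot-\mu_k)$, permutations $\Pi=\Pi(\vartheta,n)$ of $\{1,\dots,K\}$, and a sequence $\varepsilon_n\to0$ such that $$\sup_{\vartheta\in\mathscr{U}}\mathbb{P}\Big(\max_k\big(|\widehat\lambda_{n,k}-\lambda_{\Pi(k)}|\vee\|\widehat f_{n,k}-f_{\Pi(k)}\|_1\big)>\varepsilon_n\Big)\xrightarrow{n\to\infty}0.$$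
   Context: $\phi_\sigma$ is the density of $\mathcal{N}(0,\sigma^2)$; $(\phi_\sigma\ast G)(y)=\int\phi_\sigma(y-\theta)\,dG(\theta)$ for a probability measure $G$. $G(\cdot-\mu)$ is the translate of $G$ by $\mu$ (law of $\theta+\mu$, $\theta\sim G$). $\operatorname{dist}(A,B)=\inf_{x\in A,y\in B}|x-y|$; $\|\cdot\|_1$ is the $L^1(\mathbb{R})$ norm. $\mathscr{M}$ is the set of tuples $(\{f_k\}_{k=1}^K,\{\lambda_k\}_{k=1}^K,\{\mu_k\}_{k=1}^K)$, with $f_k$ probability densities on $\mathbb{R}$ and $\lambda_k,\mu_k\in\mathbb{R}$, satisfying: (B1) $f_k=\phi_\sigma\ast G_k$ with $G_k$ a compactly supported probability measure, and $\int xf_k(x)\,dx=0$; (B2) $\min_k\lambda_k>0$, $\sum_k\lambda_k=1$; (B3) $\min_{j\ne k}\operatorname{dist}\big(\operatorname{supp}(G_j(\cdot-\mu_j)),\operatorname{supp}(G_k(\cdot-\mu_k))\big)>\max_k\operatorname{diam}(\operatorname{supp}(G_k))$. $\mathbb{P}$ is the law of the sample under $\vartheta$. Estimators are functions of the sample which may depend on $K$, $\sigma$ and the family $\mathscr{U}$ (known) but not on the individual $\vartheta$. *)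

theory Defs
  imports "HOL-Probability.Probability"
begin

definition msupp :: "real measure \<Rightarrow> real set" where
  "msupp M = {x. \<forall>U. open U \<longrightarrow> x \<in> U \<longrightarrow> emeasure M U > 0}"

definition translate :: "real measure \<Rightarrow> real \<Rightarrow> real measure" where
  "translate G m = distr G borel (\<lambda>t. t + m)"

definition gauss_conv :: "real \<Rightarrow> real measure \<Rightarrow> real \<Rightarrow> real" where
  "gauss_conv \<sigma> G y = (LINT t|G. normal_density 0 \<sigma> (y - t))"

definition compact_prob :: "real measure \<Rightarrow> bool" where
  "compact_prob G \<longleftrightarrow> real_distribution G \<and> compact (msupp G)"

definition prob_density :: "(real \<Rightarrow> real) \<Rightarrow> bool" where
  "prob_density f \<longleftrightarrow> f \<in> borel_measurable borel \<and> (\<forall>x. 0 \<le> f x) \<and> prob_space (density lborel (\<lambda>x. ennreal (f x)))"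

text \<open>A tuple \<open>({f\<^sub>k}, {\<lambda>\<^sub>k}, {\<mu>\<^sub>k})\<close>. Families indexed by \<open>k = 1, \<dots>, K\<close> are functions on
  \<^typ>\<open>nat\<close>; only their values on \<open>{1..K}\<close> matter.\<close>

record mixture_tuple =
  comp :: "nat \<Rightarrow> real \<Rightarrow> real"
  weight :: "nat \<Rightarrow> real"
  shift :: "nat \<Rightarrow> real"

text \<open>The measure \<open>G\<close> with \<open>f = \<phi>\<^sub>\<sigma> \<^bold>* G\<close>. It is unique when it exists, because the Fourier
  transform of \<open>\<phi>\<^sub>\<sigma>\<close> has no zeros, so the choice is not arbitrary.\<close>

definition mixing :: "real \<Rightarrow> (real \<Rightarrow> real) \<Rightarrow> real measure" where
  "mixing \<sigma> f = (SOME G. compact_prob G \<and> f = gauss_conv \<sigma> G)"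

definition max_diam :: "nat \<Rightarrow> real \<Rightarrow> mixture_tuple \<Rightarrow> real" where
  "max_diam K \<sigma> \<theta> = (MAX k\<in>{1..K}. diameter (msupp (mixing \<sigma> (comp \<theta> k))))"

text \<open>Extended-real valued, so that the minimum over the empty index set is \<open>\<infinity>\<close> when \<open>K = 1\<close>.\<close>

definition min_dist :: "nat \<Rightarrow> real \<Rightarrow> mixture_tuple \<Rightarrow> ereal" where
  "min_dist K \<sigma> \<theta> = (INF j\<in>{1..K}. INF k\<in>{1..K} - {j}. ereal (setdist
     (msupp (translate (mixing \<sigma> (comp \<theta> j)) (shift \<theta> j)))
     (msupp (translate (mixing \<sigma> (comp \<theta> k)) (shift \<theta> k)))))"

definition mixture_class :: "nat \<Rightarrow> real \<Rightarrow> mixture_tuple set" where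
  "mixture_class K \<sigma> = {\<theta>.
     (\<forall>k\<in>{1..K}. prob_density (comp \<theta> k)) \<and>
     (\<forall>k\<in>{1..K}. (\<exists>G. compact_prob G \<and> comp \<theta> k = gauss_conv \<sigma> G) \<and>
                  has_bochner_integral lborel (\<lambda>x. x * comp \<theta> k x) 0) \<and>
     (MIN k\<in>{1..K}. weight \<theta> k) > 0 \<and> (\<Sum>k=1..K. weight \<theta> k) = 1 \<and>
     min_dist K \<sigma> \<theta> > ereal (max_diam K \<sigma> \<theta>)}"

definition mix_density :: "nat \<Rightarrow> mixture_tuple \<Rightarrow> real \<Rightarrow> real" where
  "mix_density K \<theta> x = (\<Sum>k=1..K. weight \<theta> k * comp \<theta> k (x - shift \<theta> k))"

definition sample_law :: "nat \<Rightarrow> mixture_tuple \<Rightarrow> nat \<Rightarrow> (nat \<Rightarrow> real) measure" where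
  "sample_law K \<theta> n = (\<Pi>\<^sub>M i\<in>{1..n}. density lborel (\<lambda>x. ennreal (mix_density K \<theta> x)))"

abbreviation sample_space :: "nat \<Rightarrow> (nat \<Rightarrow> real) measure" where
  "sample_space n \<equiv> (\<Pi>\<^sub>M i\<in>{1..n}. borel)"

definition real_estimator :: "nat \<Rightarrow> ((nat \<Rightarrow> real) \<Rightarrow> real) \<Rightarrow> bool" where
  "real_estimator n T \<longleftrightarrow> T \<in> borel_measurable (sample_space n)"

text \<open>An \<open>L\<^sup>1\<close>-valued statistic: joint measurability makes its \<open>L\<^sup>1\<close> errors measurable
  functions of the sample, and integrability makes the Bochner integral in \<open>L1_norm\<close> below
  the genuine norm of such an error.\<close>

definition L1_estimator :: "nat \<Rightarrow> ((nat \<Rightarrow> real) \<Rightarrow> real \<Rightarrow> real) \<Rightarrow> bool" where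
  "L1_estimator n T \<longleftrightarrow>
     (\<lambda>(s, x). T s x) \<in> borel_measurable (sample_space n \<Otimes>\<^sub>M borel) \<and>
     (\<forall>s\<in>space (sample_space n). integrable lborel (T s))"

definition L1_norm :: "(real \<Rightarrow> real) \<Rightarrow> real" where
  "L1_norm g = (LINT x|lborel. \<bar>g x\<bar>)"

end

theory Submission
  imports Defs
begin

text \<open>
  The mixing measure \<open>H = \<Sum>\<^sub>k \<lambda>\<^sub>k G\<^sub>k(\<cdot> - \<mu>\<^sub>k)\<close> is determined by the sample density \<open>\<phi>\<^sub>\<sigma> * H\<close>, since
  the Fourier transform of \<open>\<phi>\<^sub>\<sigma>\<close> has no zeros. Separation forces the translated supports into
  disjoint intervals, whose left-to-right order is a canonical labelling of the components; two such
  decompositions of the same \<open>H\<close> agree because an interval no longer than one family's longest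
  cannot meet two intervals of that family. By (D1)-(D3) and Helly's theorem the parameters range over
  a sequentially compact set, so this identifiability is uniform: for each \<open>\<delta>\<close>, closeness of the
  characteristic function at finitely many rational frequencies makes the ordered weights and
  component densities \<open>\<delta>\<close>-close. These finitely many bounded moments are estimated uniformly by
  Hoeffding's inequality; the estimator picks a matching element of a finite net of parameters, and a
  diagonal choice of \<open>\<delta>\<close> gives \<open>\<epsilon>\<^sub>n\<close>. Ordering by location makes the permutation independent of the
  sample.
\<close>

subsection \<open>Supports and Gaussian convolutions\<close>

text \<open>The centring in (B1) is what separates location from shape: a translated component has
  mean \<open>\<mu> k\<close>, so the shift, and then \<open>G k\<close> itself, can be read off it.
  Each family's own gaps exceed its own interval lengths, but nothing relates the gaps of one family
  to the lengths of another; comparing two decompositions therefore needs an asymmetric uniqueness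
  statement, applied in whichever direction fits. No rate results: uniformity comes from a
  contradiction along subsequences, so the number of frequencies and the tolerance that guarantee a
  given accuracy are only known to exist. Frequencies are rational so that they can be enumerated;
  parameters that are close at the first \<open>n\<close> frequencies for every \<open>n\<close>
  become equal in the limit at all of them, and continuity recovers the real line. For each
  \<open>n\<close> the estimator takes finitely many values, which settles its measurability without
  any structure on the set of parameters.\<close>

lemma emeasure_compl_msupp:
  assumes "sets G = sets borel"
  shows "emeasure G (- msupp G) = 0"
proof -
  define F where "F = {U. open U \<and> emeasure G U = 0}"
  \<comment> \<open>The complement of the support is a possibly uncountable union of open null sets;
    Lindelof leaves countably many, so the union is still null.\<close>
  obtain F' where F': "F' \<subseteq> F" "countable F'" "\<Union>F' = \<Union>F"
    using Lindelof[of F] by (auto simp: F_def)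
  have "- msupp G = \<Union>F"
    by (auto simp: F_def msupp_def)
  also have "\<dots> = \<Union>F'" using F' by simp
  also have "\<dots> \<in> null_sets G"
    using F' by (intro null_sets_UN'[where N="\<lambda>x. x", simplified])
      (auto simp: F_def null_sets_def assms)
  finally show ?thesis by auto
qed

lemma closed_msupp: "closed (msupp G)"
proof -
  have "- msupp G = \<Union>{U. open U \<and> emeasure G U = 0}"
    by (auto simp: msupp_def)
  then show ?thesis unfolding closed_def by auto
qed

lemma AE_msupp:
  assumes "sets G = sets borel"
  shows "AE t in G. t \<in> msupp G"
proof (rule AE_I)
  show "emeasure G (- msupp G) = 0" by (rule emeasure_compl_msupp[OF assms])
  show "- msupp G \<in> sets G"
    using closed_msupp[of G] assms by (simp add: borel_open closed_def)
qed auto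

text \<open>Supplies points of the translated supports; the distance of two such points bounds
  \<open>setdist\<close> from above in the separation argument.\<close>

lemma msupp_translate:
  assumes "sets G = sets borel" "x \<in> msupp G"
  shows "x + m \<in> msupp (translate G m)"
proof -
  have "emeasure (translate G m) U > 0" if U: "open U" "x + m \<in> U" for U
  proof -
    have m: "(\<lambda>t. t + m) \<in> measurable G borel"
      using assms(1) by (simp cong: measurable_cong_sets)
    have "open ((\<lambda>t. t + m) -` U)"
      using U by (intro open_vimage continuous_intros)
    then have "emeasure G ((\<lambda>t. t + m) -` U) > 0"
      using assms(2) U by (auto simp: msupp_def)
    then show ?thesis
      using U m sets_eq_imp_space_eq[OF assms(1)] by (simp add: translate_def emeasure_distr)
  qed
  then show ?thesis by (auto simp: msupp_def)
qed

lemma normal_density_diff: "normal_density 0 \<sigma> (x - t) = normal_density t \<sigma> x"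
  by (simp add: normal_density_def)

lemma gauss_conv_altdef: "gauss_conv \<sigma> G x = (LINT t|G. normal_density t \<sigma> x)"
  by (simp add: gauss_conv_def normal_density_diff)

text \<open>Fubini, in a form that serves three choices of \<open>h\<close>: the constant 1 (total
  mass), \<open>iexp\<close> (characteristic function) and the identity (mean). The bound is
  required only almost surely in \<open>t\<close> so that the unbounded identity is covered when
  \<open>G\<close> is carried by a bounded set.\<close>

lemma has_bochner_integral_gauss_conv_scaleR:
  fixes h :: "real \<Rightarrow> 'a::{banach, second_countable_topology}"
  assumes "real_distribution G" and [measurable]: "h \<in> borel_measurable borel"
    and bd: "AE t in G. (\<integral>\<^sup>+x. norm (normal_density t \<sigma> x *\<^sub>R h x) \<partial>lborel) \<le> ennreal C"
  shows "has_bochner_integral lborel (\<lambda>x. gauss_conv \<sigma> G x *\<^sub>R h x)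
    (LINT t|G. LINT x|lborel. normal_density t \<sigma> x *\<^sub>R h x)"
proof -
  interpret real_distribution G by fact
  interpret P: pair_sigma_finite lborel G by standard
  have sG[measurable_cong]: "sets G = sets borel" by simp
  let ?f = "\<lambda>(x, t). normal_density t \<sigma> x *\<^sub>R h x"
  have [measurable]: "(\<lambda>z. normal_density (snd z) \<sigma> (fst z)) \<in> borel_measurable (lborel \<Otimes>\<^sub>M G)"
    unfolding normal_density_def by measurable
  have fm[measurable]: "?f \<in> borel_measurable (lborel \<Otimes>\<^sub>M G)"
    unfolding split_beta by measurable
  have "(\<integral>\<^sup>+z. norm (?f z) \<partial>(lborel \<Otimes>\<^sub>M G)) =
      (\<integral>\<^sup>+t. (\<integral>\<^sup>+x. norm (normal_density t \<sigma> x *\<^sub>R h x) \<partial>lborel) \<partial>G)"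
    by (subst P.nn_integral_snd[symmetric]) auto
  also have "\<dots> \<le> (\<integral>\<^sup>+t. ennreal C \<partial>G)"
    using bd by (intro nn_integral_mono_AE)
  also have "\<dots> = ennreal C" by (simp add: emeasure_space_1 del: space_eq_univ)
  also have "\<dots> < \<infinity>" by simp
  finally have int: "integrable (lborel \<Otimes>\<^sub>M G) ?f"
    by (intro integrableI_bounded) auto
  have eq: "(LINT t|G. normal_density t \<sigma> x *\<^sub>R h x) = gauss_conv \<sigma> G x *\<^sub>R h x" for x
  proof -
    have "integrable G (\<lambda>t. normal_density t \<sigma> x)"
    proof (rule integrable_const_bound[where B="1 / sqrt (2 * pi * \<sigma>\<^sup>2)"])
      show "AE t in G. norm (normal_density t \<sigma> x) \<le> 1 / sqrt (2 * pi * \<sigma>\<^sup>2)"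
        by (auto simp: normal_density_def divide_right_mono)
      show "(\<lambda>t. normal_density t \<sigma> x) \<in> borel_measurable G"
        unfolding normal_density_def by measurable
    qed
    then show ?thesis by (simp add: gauss_conv_altdef)
  qed
  have i1: "integrable lborel (\<lambda>x. LINT t|G. normal_density t \<sigma> x *\<^sub>R h x)"
    using P.integrable_fst[OF int] .
  have "(LINT x|lborel. LINT t|G. normal_density t \<sigma> x *\<^sub>R h x) =
     (LINT t|G. LINT x|lborel. normal_density t \<sigma> x *\<^sub>R h x)"
    using P.Fubini_integral[OF int] by simp
  with i1 show ?thesis
    by (simp add: eq has_bochner_integral_iff)
qed

lemma gauss_conv_nonneg: "0 \<le> gauss_conv \<sigma> G x"
  unfolding gauss_conv_def by (intro integral_nonneg_AE) auto

lemma has_bochner_integral_gauss_conv: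
  assumes "\<sigma> > 0" "real_distribution G"
  shows "has_bochner_integral lborel (gauss_conv \<sigma> G) 1"
proof -
  interpret real_distribution G by fact
  have "(\<integral>\<^sup>+x. norm (normal_density t \<sigma> x *\<^sub>R (1::real)) \<partial>lborel) \<le> ennreal 1" for t
    using assms(1) by (simp add: nn_integral_eq_integral)
  from has_bochner_integral_gauss_conv_scaleR[OF assms(2), of "\<lambda>_. 1::real" \<sigma> 1] this
  have "has_bochner_integral lborel (gauss_conv \<sigma> G) (LINT t|G. LINT x|lborel. normal_density t \<sigma> x)"
    by simp
  then show ?thesis using assms(1) by (simp add: prob_space del: space_eq_univ)
qed

text \<open>The affine substitution \<open>x = t + \<sigma> * y\<close> reduces the integral to the
  characteristic function of the standard normal law.\<close>

lemma integral_normal_density_iexp: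
  assumes "\<sigma> > 0"
  shows "(LINT x|lborel. normal_density t \<sigma> x *\<^sub>R iexp (u * x)) = exp (- (\<sigma> * u)\<^sup>2 / 2) *\<^sub>R iexp (u * t)"
proof -
  have nd: "normal_density t \<sigma> (t + \<sigma> * x) = std_normal_density x / \<sigma>" for x
    using assms by (simp add: normal_density_def power_mult_distrib real_sqrt_mult)
  have "(LINT x|lborel. normal_density t \<sigma> x *\<^sub>R iexp (u * x)) =
      \<sigma> *\<^sub>R (LINT x|lborel. normal_density t \<sigma> (t + \<sigma> * x) *\<^sub>R iexp (u * (t + \<sigma> * x)))"
    using assms by (subst lborel_integral_real_affine[where c=\<sigma> and t=t]) auto
  also have "\<dots> = (LINT x|lborel. \<sigma> *\<^sub>R (normal_density t \<sigma> (t + \<sigma> * x) *\<^sub>R iexp (u * (t + \<sigma> * x))))"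
    by (simp only: integral_scaleR_right)
  also have "\<dots> = (LINT x|lborel. iexp (u * t) * (std_normal_density x *\<^sub>R iexp (\<sigma> * u * x)))"
  proof (intro Bochner_Integration.integral_cong refl)
    fix x
    have "iexp (u * (t + \<sigma> * x)) = iexp (u * t) * iexp (\<sigma> * u * x)"
      by (simp add: exp_add[symmetric] algebra_simps)
    then show "\<sigma> *\<^sub>R (normal_density t \<sigma> (t + \<sigma> * x) *\<^sub>R iexp (u * (t + \<sigma> * x))) =
        iexp (u * t) * (std_normal_density x *\<^sub>R iexp (\<sigma> * u * x))"
      using assms by (simp add: nd scaleR_conv_of_real)
  qed
  also have "\<dots> = iexp (u * t) * char std_normal_distribution (\<sigma> * u)"
    by (simp only: integral_mult_right_zero) (simp add: char_def integral_density)
  also have "\<dots> = exp (- (\<sigma> * u)\<^sup>2 / 2) *\<^sub>R iexp (u * t)"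
    by (simp add: char_std_normal_distribution scaleR_conv_of_real)
  finally show ?thesis .
qed

lemma has_bochner_integral_gauss_conv_iexp:
  assumes "\<sigma> > 0" "real_distribution G"
  shows "has_bochner_integral lborel (\<lambda>x. gauss_conv \<sigma> G x *\<^sub>R iexp (u * x))
    (exp (- (\<sigma> * u)\<^sup>2 / 2) *\<^sub>R char G u)"
proof -
  have "(\<integral>\<^sup>+x. norm (normal_density t \<sigma> x *\<^sub>R iexp (u * x)) \<partial>lborel) \<le> ennreal 1" for t
    using assms(1) by (simp add: nn_integral_eq_integral)
  from has_bochner_integral_gauss_conv_scaleR[OF assms(2), of "\<lambda>x. iexp (u * x)" \<sigma> 1] this
  show ?thesis
    unfolding integral_normal_density_iexp[OF assms(1)] char_def by (simp only: integral_scaleR_right) auto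
qed

text \<open>Smoothing by a centred Gaussian preserves the mean. This turns the centring of the
  density in (B1) into centring of its mixing measure.\<close>

lemma has_bochner_integral_gauss_conv_id:
  assumes "\<sigma> > 0" "real_distribution G" "AE t in G. \<bar>t\<bar> \<le> R"
  shows "has_bochner_integral lborel (\<lambda>x. x * gauss_conv \<sigma> G x) (LINT t|G. t)"
proof -
  \<comment> \<open>\<open>?D\<close> is the first absolute moment of the centred Gaussian. It is
    also the moment of \<open>\<bar>x - t\<bar>\<close> under the Gaussian centred at
    \<open>t\<close>, so \<open>?D + R\<close> is a bound uniform in
    \<open>\<bar>t\<bar> \<le> R\<close>.\<close>
  let ?D = "LINT x|lborel. normal_density 0 \<sigma> x * \<bar>x\<bar>"
  have D: "integrable lborel (\<lambda>x. normal_density 0 \<sigma> x * \<bar>x\<bar>)"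
    using integrable_normal_moment_abs[OF assms(1), of 0 1] by simp
  have "(\<integral>\<^sup>+x. norm (normal_density t \<sigma> x *\<^sub>R x) \<partial>lborel) \<le> ennreal (?D + R)" if t: "\<bar>t\<bar> \<le> R" for t
  proof -
    have i: "integrable lborel (\<lambda>x. normal_density t \<sigma> x * \<bar>x - t\<bar>)"
      using integrable_normal_moment_abs[OF assms(1), of t 1] by simp
    have "(\<integral>\<^sup>+x. norm (normal_density t \<sigma> x *\<^sub>R x) \<partial>lborel) \<le>
       (\<integral>\<^sup>+x. ennreal (normal_density t \<sigma> x * \<bar>x - t\<bar> + R * normal_density t \<sigma> x) \<partial>lborel)"
    proof (intro nn_integral_mono ennreal_leI)
      fix x
      have "normal_density t \<sigma> x * \<bar>x\<bar> \<le> normal_density t \<sigma> x * (\<bar>x - t\<bar> + R)"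
        using t by (intro mult_left_mono) auto
      then show "norm (normal_density t \<sigma> x *\<^sub>R x) \<le> normal_density t \<sigma> x * \<bar>x - t\<bar> + R * normal_density t \<sigma> x"
        by (simp add: abs_mult algebra_simps)
    qed
    also have "\<dots> = ennreal (LINT x|lborel. normal_density t \<sigma> x * \<bar>x - t\<bar> + R * normal_density t \<sigma> x)"
      using i assms(1) t by (intro nn_integral_eq_integral) auto
    also have "(LINT x|lborel. normal_density t \<sigma> x * \<bar>x - t\<bar> + R * normal_density t \<sigma> x) = ?D + R"
      using i assms(1) integral_normal_moment_abs_odd[OF assms(1), of t 0]
        integral_normal_moment_abs_odd[OF assms(1), of 0 0] by simp
    finally show ?thesis .
  qed
  with assms(3) have "AE t in G. (\<integral>\<^sup>+x. norm (normal_density t \<sigma> x *\<^sub>R x) \<partial>lborel) \<le> ennreal (?D + R)"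
    by auto
  from has_bochner_integral_gauss_conv_scaleR[OF assms(2) _ this] show ?thesis
    using integral_normal_moment_nz_1[OF assms(1)] by (simp add: mult.commute)
qed

text \<open>For fixed \<open>x\<close> the Gaussian kernel is a bounded continuous test function, so
  weak convergence gives pointwise convergence of the densities; all of them have mass one, and
  Scheffe's lemma upgrades this to convergence in \<open>L1\<close>.\<close>

lemma tendsto_L1_gauss_conv:
  assumes "\<sigma> > 0" "\<And>n. real_distribution (G n)" "real_distribution G'" "weak_conv_m G G'"
  shows "(\<lambda>n. L1_norm (\<lambda>x. gauss_conv \<sigma> (G n) x - gauss_conv \<sigma> G' x)) \<longlonglongrightarrow> 0"
proof -
  have pw: "(\<lambda>n. gauss_conv \<sigma> (G n) x) \<longlonglongrightarrow> gauss_conv \<sigma> G' x" for x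
    unfolding gauss_conv_def using assms(2-4)
  proof (rule weak_conv_imp_integral_bdd_continuous_conv)
    show "isCont (\<lambda>t. normal_density 0 \<sigma> (x - t)) y" for y
      unfolding normal_density_def using assms(1) by (intro continuous_intros) auto
    show "norm (normal_density 0 \<sigma> (x - t)) \<le> 1 / sqrt (2 * pi * \<sigma>\<^sup>2)" for t
      by (auto simp: normal_density_def divide_right_mono)
  qed
  note B = has_bochner_integral_gauss_conv[OF assms(1)]
  have int: "integrable lborel (gauss_conv \<sigma> (G n))" "integrable lborel (gauss_conv \<sigma> G')" for n
    using B[OF assms(2)] B[OF assms(3)] by (auto simp: has_bochner_integral_iff)
  have one: "(\<integral>\<^sup>+x. norm (gauss_conv \<sigma> H x) \<partial>lborel) = 1" if "real_distribution H" for H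
    using B[OF that] by (simp add: gauss_conv_nonneg nn_integral_eq_integral has_bochner_integral_iff)
  have "(\<lambda>n. \<integral>\<^sup>+ x. norm (gauss_conv \<sigma> (G n) x - gauss_conv \<sigma> G' x) \<partial>lborel) \<longlonglongrightarrow> 0"
    by (rule Scheffe_lemma2) (use int pw one assms in auto)
  moreover have "(\<integral>\<^sup>+ x. norm (gauss_conv \<sigma> (G n) x - gauss_conv \<sigma> G' x) \<partial>lborel) =
      ennreal (L1_norm (\<lambda>x. gauss_conv \<sigma> (G n) x - gauss_conv \<sigma> G' x))" for n
    unfolding L1_norm_def by (subst nn_integral_eq_integral) (use int in auto)
  ultimately show ?thesis
    by (simp add: ennreal_tendsto_0_iff L1_norm_def)
qed

subsection \<open>Identifiability of ordered mixtures\<close>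

text \<open>Induction upwards from 1 gives \<open>i \<le> g i\<close>, induction downwards from
  \<open>K\<close> gives the reverse. Applied to the matching between the intervals of two ordered
  decompositions.\<close>

lemma strict_mono_on_interval_id:
  fixes g :: "nat \<Rightarrow> nat"
  assumes "strict_mono_on {1..K} g" "g ` {1..K} \<subseteq> {1..K}" "k \<in> {1..K}"
  shows "g k = k"
proof -
  have ge: "i \<le> g i" if "i \<in> {1..K}" for i
    using that
  proof (induction i)
    case (Suc i)
    show ?case
    proof (cases "i = 0")
      case True
      then show ?thesis using Suc assms(2) by force
    next
      case False
      then have "g i < g (Suc i)" "i \<le> g i"
        using Suc assms(1) by (auto simp: strict_mono_on_def)
      then show ?thesis by simp
    qed
  qed simp
  have le: "g (K - d) \<le> K - d" if "d < K" for d
    using that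
  proof (induction d)
    case 0
    then have "K \<in> {1..K}" by simp
    then show ?case using assms(2) by fastforce
  next
    case (Suc d)
    then have "g (K - Suc d) < g (K - d)"
      by (intro strict_mono_onD[OF assms(1)]) auto
    then show ?case using Suc by simp
  qed
  show ?thesis using ge[OF assms(3)] le[of "K - k"] assms(3) by simp
qed

text \<open>Obtained as the monadic bind of a finitely supported \<open>pmf\<close> with the
  component laws. An actual measure is needed because Levy's uniqueness theorem is a statement about
  distributions, not about weighted sums.\<close>

lemma ex_finite_mixture:
  fixes w :: "'i \<Rightarrow> real" and \<nu> :: "'i \<Rightarrow> real measure"
  assumes "finite I" "\<And>k. k \<in> I \<Longrightarrow> 0 \<le> w k" "(\<Sum>k\<in>I. w k) = 1"
    and \<nu>: "\<And>k. k \<in> I \<Longrightarrow> real_distribution (\<nu> k)"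
  obtains H where "real_distribution H"
    "\<And>A. A \<in> sets borel \<Longrightarrow> measure H A = (\<Sum>k\<in>I. w k * measure (\<nu> k) A)"
    "\<And>t. char H t = (\<Sum>k\<in>I. w k *\<^sub>R char (\<nu> k) t)"
proof -
  \<comment> \<open>Off \<open>I\<close> the weight is 0 and the law a dummy point mass, so that
    \<open>f\<close> and \<open>N\<close> are total and \<open>N\<close> is a kernel
    everywhere.\<close>
  define f where "f k = (if k \<in> I then w k else 0)" for k
  define N where "N k = (if k \<in> I then \<nu> k else return borel 0)" for k
  define p where "p = embed_pmf f"
  have N: "real_distribution (N k)" for k
    using \<nu> by (auto simp: N_def real_distribution_def real_distribution_axioms_def prob_space_return)
  have f: "0 \<le> f k" for k using assms by (simp add: f_def)
  have "(\<integral>\<^sup>+k. ennreal (f k) \<partial>count_space UNIV) = (\<Sum>k\<in>I. ennreal (f k))"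
    using assms(1) by (intro nn_integral_count_space') (auto simp: f_def)
  also have "\<dots> = 1" using assms by (simp add: f_def cong: sum.cong)
  finally have p: "pmf p k = f k" for k
    unfolding p_def using f by (intro pmf_embed_pmf) auto
  have sp: "set_pmf p \<subseteq> I" by (auto simp: set_pmf_iff p f_def split: if_splits)
  have Nm: "N \<in> measurable (measure_pmf p) (subprob_algebra borel)"
    using N by (auto simp: space_subprob_algebra real_distribution_def real_distribution_axioms_def
      intro!: prob_space_imp_subprob_space)
  have Np: "N \<in> measurable (measure_pmf p) (prob_algebra borel)"
    using N by (auto simp: space_prob_algebra real_distribution_def real_distribution_axioms_def)
  define H where "H = measure_pmf p \<bind> N"
  have sH: "sets H = sets borel"
    unfolding H_def using N by (intro sets_bind) (auto simp: real_distribution.events_eq_borel)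
  have "prob_space H"
    unfolding H_def using Np
    by (intro prob_space_bind'[of _ "count_space UNIV"]) (auto simp: space_prob_algebra measure_pmf.prob_space_axioms)
  then have H: "real_distribution H"
    using sH by (simp add: real_distribution_def real_distribution_axioms_def)
  have fin: "(LINT k|measure_pmf p. u k) = (\<Sum>k\<in>I. w k * u k)" for u :: "'i \<Rightarrow> real"
    using assms(1) sp by (subst integral_measure_pmf_real[of I]) (auto simp: p f_def mult.commute)
  have m: "measure H A = (\<Sum>k\<in>I. w k * measure (\<nu> k) A)" if "A \<in> sets borel" for A
    unfolding H_def
    by (subst measure_pmf.measure_bind[OF Nm that]) (simp add: fin N_def)
  have i: "(LINT x|H. h x) = (\<Sum>k\<in>I. w k * (LINT x|\<nu> k. h x))"
    if [measurable]: "h \<in> borel_measurable borel" and "\<And>x. \<bar>h x\<bar> \<le> 1" for h :: "real \<Rightarrow> real"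
  proof -
    have "(LINT x|H. h x) = (LINT k|measure_pmf p. (LINT x|N k. h x))"
      unfolding H_def
    proof (rule integral_bind[where K=borel and B'=1 and B=1])
      show "AE x in measure_pmf p. emeasure (N x) (space (N x)) \<le> ennreal 1"
        using N by (auto simp: real_distribution_def prob_space.emeasure_space_1)
    qed (use that Nm in auto)
    then show ?thesis by (simp add: fin N_def)
  qed
  \<comment> \<open>The bind formula above is for real integrands, so the characteristic function is
    handled through cosine and sine.\<close>
  have rei: "Re (char M t) = (LINT x|M. cos (t * x))" "Im (char M t) = (LINT x|M. sin (t * x))"
    if "real_distribution M" for M t
  proof -
    interpret real_distribution M by fact
    have int: "integrable M (\<lambda>x. iexp (t * x))"
      by (intro integrable_const_bound[where B=1]) auto
    show "Re (char M t) = (LINT x|M. cos (t * x))" "Im (char M t) = (LINT x|M. sin (t * x))"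
      unfolding char_def using int
      by (simp_all add: Re_exp Im_exp flip: integral_Re integral_Im)
  qed
  have c: "char H t = (\<Sum>k\<in>I. w k *\<^sub>R char (\<nu> k) t)" for t
    using i[of "\<lambda>x. cos (t * x)"] i[of "\<lambda>x. sin (t * x)"]
    by (intro complex_eqI) (simp_all add: rei H \<nu>)
  show thesis by (rule that[OF H m c])
qed

text \<open>The primed intervals are short compared with the unprimed gaps, and otherwise only
  ordered. Hence each primed component charges exactly one unprimed interval \<open>g i\<close>. The
  map \<open>g\<close> is onto because every unprimed interval carries mass, and increasing because
  both families are ordered, so it is the identity.\<close>

lemma ordered_mixture_unique:
  fixes w w' a b a' b' :: "nat \<Rightarrow> real" and \<nu> \<nu>' :: "nat \<Rightarrow> real measure"
  assumes \<nu>: "\<And>k. k \<in> {1..K} \<Longrightarrow> real_distribution (\<nu> k)"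
    and \<nu>': "\<And>k. k \<in> {1..K} \<Longrightarrow> real_distribution (\<nu>' k)"
    and w: "\<And>k. k \<in> {1..K} \<Longrightarrow> 0 < w k" and w': "\<And>k. k \<in> {1..K} \<Longrightarrow> 0 < w' k"
    and ab: "\<And>k. k \<in> {1..K} \<Longrightarrow> AE t in \<nu> k. t \<in> {a k..b k}"
    and ab': "\<And>k. k \<in> {1..K} \<Longrightarrow> AE t in \<nu>' k. t \<in> {a' k..b' k}"
    and sep: "\<And>j k l. \<lbrakk>j \<in> {1..K}; k \<in> {1..K}; l \<in> {1..K}; j < k\<rbrakk> \<Longrightarrow> b' l - a' l < a k - b j"
    and ord: "\<And>j k. \<lbrakk>j \<in> {1..K}; k \<in> {1..K}; j < k\<rbrakk> \<Longrightarrow> b' j < a' k"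
    and eq: "\<And>A. A \<in> sets borel \<Longrightarrow>
      (\<Sum>k=1..K. w k * measure (\<nu> k) A) = (\<Sum>k=1..K. w' k * measure (\<nu>' k) A)"
    and k: "k \<in> {1..K}"
  shows "w k = w' k \<and> \<nu> k = \<nu>' k"
proof -
  have null: "measure M A = 0 \<longleftrightarrow> (AE t in M. t \<notin> A)" if "real_distribution M" "A \<in> sets borel" for M A
  proof -
    interpret real_distribution M by fact
    show ?thesis using that(2) by (simp add: prob_eq_0)
  qed
  have notF: "\<not> (AE t in M. False)" if "real_distribution M" for M :: "real measure"
  proof -
    interpret real_distribution M by fact
    show ?thesis by (simp add: AE_False)
  qed
  have meet: "\<exists>x. x \<in> {a j..b j} \<and> x \<in> {a' i..b' i}"
    if "i \<in> {1..K}" "j \<in> {1..K}" "measure (\<nu>' i) {a j..b j} \<noteq> 0" for i j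
  proof (rule ccontr)
    assume "\<not> ?thesis"
    then have "AE t in \<nu>' i. t \<notin> {a j..b j}"
      by (intro eventually_mono[OF ab'[OF that(1)]]) auto
    then show False using that null[OF \<nu>'[OF that(1)], of "{a j..b j}"] by auto
  qed
  \<comment> \<open>Nonnegative lengths on the primed side turn \<open>sep\<close> into positive
    gaps, so the unprimed intervals are disjoint.\<close>
  have len: "a' i \<le> b' i" if "i \<in> {1..K}" for i
  proof (rule ccontr)
    assume "\<not> ?thesis"
    then have "AE t in \<nu>' i. False" using ab'[OF that] by auto
    then show False using notF[OF \<nu>'[OF that]] by simp
  qed
  let ?U = "\<Union>j\<in>{1..K}. {a j..b j}"
  have U: "?U \<in> sets borel" by auto
  \<comment> \<open>The complement of the unprimed intervals has mass zero on the left of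
    \<open>eq\<close>; on the right a sum of nonnegative terms with positive weights then vanishes
    term by term.\<close>
  have AE_U: "AE t in \<nu>' i. t \<in> ?U" if i: "i \<in> {1..K}" for i
  proof -
    define V where "V = - ?U"
    have V: "V \<in> sets borel" unfolding V_def using U by (rule borel_comp)
    have "AE t in \<nu> j. t \<notin> V" if "j \<in> {1..K}" for j
      by (rule eventually_mono[OF ab[OF that]]) (use that in \<open>auto simp: V_def\<close>)
    then have "measure (\<nu> j) V = 0" if "j \<in> {1..K}" for j
      using null[OF \<nu>[OF that] V] that by auto
    then have "(\<Sum>k=1..K. w' k * measure (\<nu>' k) V) = 0"
      using eq[OF V] by simp
    then have "w' i * measure (\<nu>' i) V = 0"
      using i w' by (subst (asm) sum_nonneg_eq_0_iff) (auto simp: less_imp_le)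
    then have "AE t in \<nu>' i. t \<notin> V"
      using w'[OF i] null[OF \<nu>'[OF i] V] by auto
    then show ?thesis by (simp add: V_def)
  qed
  have "\<exists>j\<in>{1..K}. measure (\<nu>' i) {a j..b j} \<noteq> 0" if i: "i \<in> {1..K}" for i
  proof (rule ccontr)
    assume c: "\<not> ?thesis"
    note AE_U[OF i]
    moreover have "AE t in \<nu>' i. \<forall>j\<in>{1..K}. t \<notin> {a j..b j}"
      using c null[OF \<nu>'[OF i]] by (intro AE_finite_allI) auto
    ultimately have "AE t in \<nu>' i. False" by eventually_elim auto
    then show False using notF[OF \<nu>'[OF i]] by simp
  qed
  then obtain g where g: "\<And>i. i \<in> {1..K} \<Longrightarrow> g i \<in> {1..K} \<and> measure (\<nu>' i) {a (g i)..b (g i)} \<noteq> 0"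
    by metis
  \<comment> \<open>If \<open>\<nu>' i\<close> charged two unprimed intervals, its own interval
    would contain a point of each and would be at least as long as the gap between them.\<close>
  have g_only: "g i = j"
    if ij: "i \<in> {1..K}" "j \<in> {1..K}" "measure (\<nu>' i) {a j..b j} \<noteq> 0" for i j
  proof (rule ccontr)
    assume ne: "g i \<noteq> j"
    obtain x where x: "x \<in> {a j..b j}" "x \<in> {a' i..b' i}" using meet[OF ij] by auto
    obtain y where y: "y \<in> {a (g i)..b (g i)}" "y \<in> {a' i..b' i}" using meet[of i "g i"] ij g by auto
    show False
      using ne sep[of j "g i" i] sep[of "g i" j i] g[OF ij(1)] ij x y
      by (cases "g i < j") auto
  qed
  \<comment> \<open>The interval of \<open>\<nu> j\<close> has positive mass in the left mixture,
    hence in the right one, so some primed component charges it.\<close>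
  have surj: "\<exists>i\<in>{1..K}. g i = j" if j: "j \<in> {1..K}" for j
  proof -
    interpret real_distribution "\<nu> j" using \<nu>[OF j] .
    have "measure (\<nu> j) {a j..b j} = 1" using ab[OF j] by (subst prob_eq_1) auto
    then have "0 < w j * measure (\<nu> j) {a j..b j}" using w[OF j] by simp
    also have "\<dots> \<le> (\<Sum>k=1..K. w k * measure (\<nu> k) {a j..b j})"
      using j w by (intro member_le_sum) (auto simp: less_imp_le)
    also have "\<dots> = (\<Sum>k=1..K. w' k * measure (\<nu>' k) {a j..b j})" by (intro eq) auto
    finally obtain i where "i \<in> {1..K}" "measure (\<nu>' i) {a j..b j} \<noteq> 0"
      by (metis (no_types, lifting) less_irrefl mult_zero_right sum.neutral)
    then show ?thesis using g_only j by blast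
  qed
  then have "{1..K} \<subseteq> g ` {1..K}" by blast
  then have gim: "g ` {1..K} = {1..K}" using g by blast
  then have inj: "inj_on g {1..K}" by (intro eq_card_imp_inj_on) auto
  have "strict_mono_on {1..K} g"
  proof (rule strict_mono_onI)
    fix i l assume il: "i \<in> {1..K}" "l \<in> {1..K}" "i < l"
    obtain x where x: "x \<in> {a (g i)..b (g i)}" "x \<in> {a' i..b' i}" using meet[of i "g i"] il g by auto
    obtain y where y: "y \<in> {a (g l)..b (g l)}" "y \<in> {a' l..b' l}" using meet[of l "g l"] il g by auto
    have "g i \<noteq> g l" using inj il by (auto dest: inj_onD)
    moreover have "\<not> g l < g i"
      using sep[of "g l" "g i" i] g il x y ord[OF il] by fastforce
    ultimately show "g i < g l" by simp
  qed
  then have gid: "g i = i" if "i \<in> {1..K}" for i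
    using strict_mono_on_interval_id[of K g i] gim that by simp
  \<comment> \<open>Intersecting with \<open>{a k..b k}\<close> isolates the \<open>k\<close>-th
    component in both mixtures, so \<open>eq\<close> at this set compares single terms. Taking
    \<open>A = UNIV\<close> gives the weights, after which they cancel.\<close>
  have key: "w k * measure (\<nu> k) A = w' k * measure (\<nu>' k) A" if A: "A \<in> sets borel" for A
  proof -
    have z: "measure (\<nu> j) (A \<inter> {a k..b k}) = (if j = k then measure (\<nu> k) A else 0)"
      if j: "j \<in> {1..K}" for j
    proof -
      interpret real_distribution "\<nu> j" using \<nu>[OF j] .
      show ?thesis
      proof (cases "j = k")
        case True
        have "measure (\<nu> j) (A \<inter> {a k..b k}) = measure (\<nu> j) A"
        proof (rule finite_measure_eq_AE)
          show "AE t in \<nu> j. t \<in> A \<inter> {a k..b k} \<longleftrightarrow> t \<in> A"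
            by (rule eventually_mono[OF ab[OF j]]) (use True in auto)
        qed (use A in auto)
        then show ?thesis using True by simp
      next
        case False
        have disj: "{a j..b j} \<inter> {a k..b k} = {}"
          using False sep[of j k j] sep[of k j j] j k len[OF j] by (cases "j < k") auto
        have "AE t in \<nu> j. t \<notin> A \<inter> {a k..b k}"
          by (rule eventually_mono[OF ab[OF j]]) (use disj in blast)
        then show ?thesis using False A null[OF \<nu>[OF j]] by auto
      qed
    qed
    have z': "measure (\<nu>' j) (A \<inter> {a k..b k}) = (if j = k then measure (\<nu>' k) A else 0)"
      if j: "j \<in> {1..K}" for j
    proof -
      interpret real_distribution "\<nu>' j" using \<nu>'[OF j] .
      have nz: "AE t in \<nu>' j. t \<notin> {a i..b i}" if "i \<in> {1..K}" "i \<noteq> j" for i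
        using that g_only[of j i] gid[OF j] j null[OF \<nu>'[OF j], of "{a i..b i}"] by auto
      show ?thesis
      proof (cases "j = k")
        case True
        note AE_U[OF j]
        moreover have "AE t in \<nu>' j. \<forall>i\<in>{1..K} - {j}. t \<notin> {a i..b i}"
          using nz by (intro AE_finite_allI) auto
        ultimately have AE: "AE t in \<nu>' j. t \<in> {a k..b k}"
          by eventually_elim (use True in auto)
        have "measure (\<nu>' j) (A \<inter> {a k..b k}) = measure (\<nu>' j) A"
        proof (rule finite_measure_eq_AE)
          show "AE t in \<nu>' j. t \<in> A \<inter> {a k..b k} \<longleftrightarrow> t \<in> A"
            by (rule eventually_mono[OF AE]) auto
        qed (use A in auto)
        then show ?thesis using True by simp
      next
        case False
        have "AE t in \<nu>' j. t \<notin> A \<inter> {a k..b k}"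
          using nz[OF k] False by (auto elim!: eventually_mono)
        then show ?thesis using False A null[OF \<nu>'[OF j]] by auto
      qed
    qed
    have "w k * measure (\<nu> k) A = (\<Sum>j=1..K. if j = k then w k * measure (\<nu> k) A else 0)"
      using k by (subst sum.delta) auto
    also have "\<dots> = (\<Sum>j=1..K. w j * measure (\<nu> j) (A \<inter> {a k..b k}))"
      by (intro sum.cong refl) (use z in auto)
    also have "\<dots> = (\<Sum>j=1..K. w' j * measure (\<nu>' j) (A \<inter> {a k..b k}))"
      using A by (intro eq) auto
    also have "\<dots> = (\<Sum>j=1..K. if j = k then w' k * measure (\<nu>' k) A else 0)"
      by (intro sum.cong refl) (use z' in auto)
    also have "\<dots> = w' k * measure (\<nu>' k) A"
      using k by (subst sum.delta) auto
    finally show ?thesis .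
  qed
  interpret M: real_distribution "\<nu> k" using \<nu>[OF k] .
  interpret M': real_distribution "\<nu>' k" using \<nu>'[OF k] .
  have ww: "w k = w' k" using key[of UNIV] M.prob_space M'.prob_space by simp
  moreover have "\<nu> k = \<nu>' k"
  proof (rule measure_eqI)
    fix A assume "A \<in> sets (\<nu> k)"
    then show "emeasure (\<nu> k) A = emeasure (\<nu>' k) A"
      using key[of A] ww w'[OF k] by (simp add: M.emeasure_eq_measure M'.emeasure_eq_measure)
  qed simp
  ultimately show ?thesis ..
qed

subsection \<open>Compactness of the parameter space\<close>

text \<open>Successive refinement over the indices: by \<open>sub\<close>, what was achieved for
  earlier indices survives each further extraction.\<close>

lemma finite_family_common_subseq:
  fixes P :: "'i \<Rightarrow> (nat \<Rightarrow> nat) \<Rightarrow> bool"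
  assumes "finite I"
    and ex: "\<And>i s. i \<in> I \<Longrightarrow> strict_mono s \<Longrightarrow> \<exists>r. strict_mono (r :: nat \<Rightarrow> nat) \<and> P i (\<lambda>n. s (r n))"
    and sub: "\<And>i s (r :: nat \<Rightarrow> nat). i \<in> I \<Longrightarrow> strict_mono r \<Longrightarrow> P i s \<Longrightarrow> P i (\<lambda>n. s (r n))"
  shows "\<exists>s. strict_mono s \<and> (\<forall>i\<in>I. P i s)"
  using assms
proof (induction I rule: finite_induct)
  case empty
  show ?case by (rule exI[of _ id]) (simp add: strict_mono_id)
next
  case (insert i I)
  then obtain s where s: "strict_mono s" "\<And>j. j \<in> I \<Longrightarrow> P j s" by blast
  with insert.prems(1)[of i s] obtain r where r: "strict_mono r" "P i (\<lambda>n. s (r n))" by blast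
  show ?case
  proof (intro exI[of _ "\<lambda>n. s (r n)"] conjI ballI)
    show "strict_mono (\<lambda>n. s (r n))" using s(1) r(1) by (simp add: strict_mono_def)
    show "P j (\<lambda>n. s (r n))" if "j \<in> insert i I" for j
      using that r s(2) insert.prems(2)[of j r s] by auto
  qed
qed

text \<open>The test function \<open>h\<close> is the distance to \<open>{a'..b'}\<close> truncated
  at 1: bounded, continuous, and zero exactly on that interval. Its expectation under
  \<open>G n\<close> is at most the displacement of the endpoints, which tends to 0.\<close>

lemma weak_conv_AE_interval:
  assumes G: "\<And>n. real_distribution (G n)" "real_distribution G'" "weak_conv_m G G'"
    and ab: "\<And>n. AE t in G n. t \<in> {a n..b n}" and lim: "a \<longlonglongrightarrow> a'" "b \<longlonglongrightarrow> b'"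
  shows "AE t in G'. t \<in> {a'..b'}"
proof -
  interpret G': real_distribution G' by fact
  define h where "h t = min 1 (max 0 (max (a' - t) (t - b')))" for t :: real
  have h[measurable]: "h \<in> borel_measurable borel" unfolding h_def[abs_def] by measurable
  have h0: "0 \<le> h t" and h1: "\<bar>h t\<bar> \<le> 1" for t by (auto simp: h_def)
  have "(\<lambda>n. LINT t|G n. h t) \<longlonglongrightarrow> (LINT t|G'. h t)"
    using G h1 by (intro weak_conv_imp_integral_bdd_continuous_conv[where B=1])
      (auto simp: h_def intro!: continuous_intros)
  moreover have "(LINT t|G n. h t) \<le> max 0 (max (a' - a n) (b n - b'))" for n
  proof -
    interpret real_distribution "G n" by fact
    have "(LINT t|G n. h t) \<le> (LINT t|G n. max 0 (max (a' - a n) (b n - b')))"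
    proof (rule integral_mono_AE)
      show "integrable (G n) h" by (rule integrable_const_bound[where B=1]) (use h1 in auto)
      show "AE t in G n. h t \<le> max 0 (max (a' - a n) (b n - b'))"
        by (rule eventually_mono[OF ab]) (auto simp: h_def)
    qed auto
    then show ?thesis by (simp add: prob_space del: space_eq_univ)
  qed
  moreover have "(\<lambda>n. max 0 (max (a' - a n) (b n - b'))) \<longlonglongrightarrow> max 0 (max (a' - a') (b' - b'))"
    using lim by (intro tendsto_intros)
  ultimately have "(LINT t|G'. h t) \<le> 0"
    by (auto intro: LIMSEQ_le)
  moreover have "0 \<le> (LINT t|G'. h t)" using h0 by (intro integral_nonneg_AE) auto
  ultimately have "(LINT t|G'. h t) = 0" by simp
  moreover have "integrable G' h" by (rule G'.integrable_const_bound[where B=1]) (use h1 in auto)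
  ultimately have "AE t in G'. h t = 0"
    using h0 by (subst (asm) integral_nonneg_eq_0_iff_AE) auto
  then show ?thesis by (rule eventually_mono) (auto simp: h_def min_def max_def split: if_splits)
qed

text \<open>The identity is not a bounded test function, but clamping it to \<open>{-B..B}\<close>
  changes none of the integrals.\<close>

lemma weak_conv_tendsto_mean:
  assumes G: "\<And>n. real_distribution (G n)" "real_distribution G'" "weak_conv_m G G'"
    and B: "\<And>n. AE t in G n. \<bar>t\<bar> \<le> B" "AE t in G'. \<bar>t\<bar> \<le> B"
  shows "(\<lambda>n. LINT t|G n. t) \<longlonglongrightarrow> (LINT t|G'. t)"
proof -
  define h where "h t = max (-B) (min B t)" for t :: real
  have eq: "(LINT t|M. t) = (LINT t|M. h t)" if "real_distribution M" "AE t in M. \<bar>t\<bar> \<le> B" for M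
  proof -
    interpret real_distribution M by fact
    show ?thesis
    proof (rule integral_cong_AE)
      show "AE t in M. t = h t"
        by (rule eventually_mono[OF that(2)]) (auto simp: h_def)
    qed (auto simp: h_def)
  qed
  have "(\<lambda>n. LINT t|G n. h t) \<longlonglongrightarrow> (LINT t|G'. h t)"
    using G by (intro weak_conv_imp_integral_bdd_continuous_conv[where B="\<bar>B\<bar>"])
      (auto simp: h_def intro!: continuous_intros)
  then show ?thesis using G B by (simp add: eq)
qed

lemma weak_conv_m_subseq:
  "weak_conv_m G G' \<Longrightarrow> strict_mono r \<Longrightarrow> weak_conv_m (\<lambda>n. G (r n)) G'"
  unfolding weak_conv_m_def weak_conv_def using LIMSEQ_subseq_LIMSEQ by (fastforce simp: o_def)

lemma Helly_bounded_support:
  assumes G: "\<And>n. real_distribution (G n)" and B: "\<And>n. AE t in G n. \<bar>t\<bar> \<le> B"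
  obtains r G' where "strict_mono (r :: nat \<Rightarrow> nat)" "real_distribution G'" "weak_conv_m (\<lambda>n. G (r n)) G'"
proof -
  \<comment> \<open>Tightness is stated with half-open intervals: the added 1 keeps the lower
    endpoint of the support inside, and the absolute value makes the interval proper whatever the
    sign of \<open>B\<close>.\<close>
  have "measure (G n) {-\<bar>B\<bar>-1<..\<bar>B\<bar>+1} = 1" for n
  proof -
    interpret real_distribution "G n" by fact
    have "AE t in G n. t \<in> {-\<bar>B\<bar>-1<..\<bar>B\<bar>+1}"
      by (rule eventually_mono[OF B]) auto
    then show ?thesis by (subst prob_eq_1) auto
  qed
  then have "tight G"
    unfolding tight_def using G
    by (intro conjI allI impI exI[of _ "-\<bar>B\<bar>-1"] exI[of _ "\<bar>B\<bar>+1"]) auto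
  then obtain r M where "strict_mono (r :: nat \<Rightarrow> nat)" "real_distribution M" "weak_conv_m (G \<circ> id \<circ> r) M"
    using tight_imp_convergent_subsubsequence[OF _ strict_mono_id] by blast
  with that[of r M] show thesis by (simp add: o_def)
qed

text \<open>
  The support of a weak limit can be smaller than the limit of the supports. Enclosing intervals
  \<open>[a\<^sub>k, b\<^sub>k]\<close> are used instead: their endpoints converge along subsequences, and the gap condition
  passes to the limit.
\<close>

definition admissible ::
    "nat \<Rightarrow> real \<Rightarrow> real \<Rightarrow> real \<Rightarrow> (nat \<Rightarrow> real) \<Rightarrow> (nat \<Rightarrow> real) \<Rightarrow> (nat \<Rightarrow> real measure) \<Rightarrow>
      (nat \<Rightarrow> real) \<Rightarrow> (nat \<Rightarrow> real) \<Rightarrow> bool" where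
  "admissible K B m c w \<mu> G a b \<longleftrightarrow>
    (\<forall>k\<in>{1..K}. m \<le> w k \<and> \<bar>\<mu> k\<bar> \<le> B \<and> real_distribution (G k) \<and> -B \<le> a k \<and> a k \<le> b k \<and> b k \<le> B \<and>
      (AE t in G k. t \<in> {a k..b k}) \<and> (LINT t|G k. t) = 0) \<and>
    (\<Sum>k=1..K. w k) = 1 \<and>
    (\<forall>j\<in>{1..K}. \<forall>k\<in>{1..K}. \<forall>l\<in>{1..K}. j < k \<longrightarrow> b l - a l + c \<le> (a k + \<mu> k) - (b j + \<mu> j))"

lemma admissibleD:
  assumes "admissible K B m c w \<mu> G a b" "k \<in> {1..K}"
  shows "m \<le> w k" "\<bar>\<mu> k\<bar> \<le> B" "real_distribution (G k)" "-B \<le> a k" "a k \<le> b k" "b k \<le> B"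
    "AE t in G k. t \<in> {a k..b k}" "(LINT t|G k. t) = 0"
  using assms unfolding admissible_def by blast+

lemma admissible_sum:
  "admissible K B m c w \<mu> G a b \<Longrightarrow> (\<Sum>k=1..K. w k) = 1"
  unfolding admissible_def by blast

lemma admissible_gap:
  assumes "admissible K B m c w \<mu> G a b" "j \<in> {1..K}" "k \<in> {1..K}" "l \<in> {1..K}" "j < k"
  shows "b l - a l + c \<le> (a k + \<mu> k) - (b j + \<mu> j)"
  using assms unfolding admissible_def by blast

lemma admissible_abs_le:
  assumes "admissible K B m c w \<mu> G a b" "k \<in> {1..K}"
  shows "AE t in G k. \<bar>t\<bar> \<le> B"
proof -
  show ?thesis
    by (rule eventually_mono[OF admissibleD(7)[OF assms]]) (use admissibleD(4,6)[OF assms] in auto)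
qed

text \<open>Every clause of \<open>admissible\<close> is an equation or a non-strict inequality that
  passes to the limit. This is why it carries fixed constants \<open>m\<close> and \<open>c\<close>:
  bare positivity of weights and gaps could be lost.\<close>

lemma admissible_compact:
  fixes w \<mu> a b :: "nat \<Rightarrow> nat \<Rightarrow> real" and G :: "nat \<Rightarrow> nat \<Rightarrow> real measure"
  assumes adm: "\<And>n. admissible K B m c (w n) (\<mu> n) (G n) (a n) (b n)" and m: "0 < m"
  shows "\<exists>r w' \<mu>' G' a' b'. strict_mono (r :: nat \<Rightarrow> nat) \<and> admissible K B m c w' \<mu>' G' a' b' \<and>
    (\<forall>k\<in>{1..K}. (\<lambda>n. w (r n) k) \<longlonglongrightarrow> w' k \<and> (\<lambda>n. \<mu> (r n) k) \<longlonglongrightarrow> \<mu>' k \<and>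
      weak_conv_m (\<lambda>n. G (r n) k) (G' k))"
proof -
  have bds: "m \<le> w n k" "w n k \<le> 1" "\<bar>\<mu> n k\<bar> \<le> B" "-B \<le> a n k" "a n k \<le> b n k" "b n k \<le> B"
    if k: "k \<in> {1..K}" for n k
  proof -
    have "w n k \<le> (\<Sum>k=1..K. w n k)"
    proof (rule member_le_sum)
      show "0 \<le> w n i" if "i \<in> {1..K} - {k}" for i
        using admissibleD(1)[OF adm[of n], of i] that m by auto
    qed (use k in auto)
    then show "w n k \<le> 1" using admissible_sum[OF adm[of n]] by simp
  qed (use admissibleD[OF adm[of n] k] in auto)
  have G: "real_distribution (G n k)" "AE t in G n k. t \<in> {a n k..b n k}" if "k \<in> {1..K}" for n k
    using admissibleD[OF adm[of n] that] by auto
  note B = admissible_abs_le[OF adm]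
  define P where "P k s \<longleftrightarrow> convergent (\<lambda>n. w (s n) k) \<and> convergent (\<lambda>n. \<mu> (s n) k) \<and>
     convergent (\<lambda>n. a (s n) k) \<and> convergent (\<lambda>n. b (s n) k) \<and>
     (\<exists>G'. real_distribution G' \<and> weak_conv_m (\<lambda>n. G (s n) k) G')" for k and s :: "nat \<Rightarrow> nat"
  have "\<exists>s. strict_mono s \<and> (\<forall>k\<in>{1..K}. P k s)"
  proof (rule finite_family_common_subseq)
    fix k and s :: "nat \<Rightarrow> nat" assume k: "k \<in> {1..K}" and s: "strict_mono s"
    \<comment> \<open>The four real sequences are packed into one bounded sequence for a single use
      of Bolzano-Weierstrass; Helly's theorem then refines the subsequence for the measures.\<close>
    define X where "X n = (w (s n) k, \<mu> (s n) k, a (s n) k, b (s n) k)" for n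
    have "X n \<in> {0..1} \<times> {-B..B} \<times> {-B..B} \<times> {-B..B}" for n
      using bds[OF k, of "s n"] m by (auto simp: X_def abs_le_iff)
    then have "range X \<subseteq> {0..1} \<times> {-B..B} \<times> {-B..B} \<times> {-B..B}" by blast
    then have "bounded (range X)"
      by (rule bounded_subset[rotated]) (intro bounded_Times bounded_closed_interval)
    from bounded_imp_convergent_subsequence[OF this] obtain l r where r: "strict_mono r" "(X \<circ> r) \<longlonglongrightarrow> l"
      by blast
    note l = tendsto_fst[OF r(2)] tendsto_snd[OF r(2)]
    have conv: "(\<lambda>n. w (s (r n)) k) \<longlonglongrightarrow> fst l" "(\<lambda>n. \<mu> (s (r n)) k) \<longlonglongrightarrow> fst (snd l)"
      "(\<lambda>n. a (s (r n)) k) \<longlonglongrightarrow> fst (snd (snd l))" "(\<lambda>n. b (s (r n)) k) \<longlonglongrightarrow> snd (snd (snd l))"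
      using l tendsto_fst[OF l(2)] tendsto_snd[OF l(2)] tendsto_fst[OF tendsto_snd[OF l(2)]]
        tendsto_snd[OF tendsto_snd[OF l(2)]] by (simp_all add: X_def o_def)
    obtain q G' where q: "strict_mono q" "real_distribution G'" "weak_conv_m (\<lambda>n. G (s (r (q n))) k) G'"
      by (rule Helly_bounded_support[of "\<lambda>n. G (s (r n)) k" B]) (use G[OF k] B[OF k] in auto)
    have "P k (\<lambda>n. s (r (q n)))"
      unfolding P_def
      using q conv[THEN LIMSEQ_subseq_LIMSEQ, OF q(1)] unfolding convergent_def o_def by blast
    then show "\<exists>r. strict_mono r \<and> P k (\<lambda>n. s (r n))"
      using r(1) q(1) by (intro exI[of _ "\<lambda>n. r (q n)"]) (simp add: strict_mono_def)
  next
    fix k and s r :: "nat \<Rightarrow> nat" assume "strict_mono r" "P k s"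
    then show "P k (\<lambda>n. s (r n))"
      unfolding P_def using weak_conv_m_subseq[of "\<lambda>n. G (s n) k" _ r]
        convergent_subseq_convergent[of "\<lambda>n. w (s n) k" r] convergent_subseq_convergent[of "\<lambda>n. \<mu> (s n) k" r]
        convergent_subseq_convergent[of "\<lambda>n. a (s n) k" r] convergent_subseq_convergent[of "\<lambda>n. b (s n) k" r]
      by (auto simp: o_def)
  qed simp
  then obtain s where s: "strict_mono s" "\<And>k. k \<in> {1..K} \<Longrightarrow> P k s" by blast
  then obtain G' where G': "\<And>k. k \<in> {1..K} \<Longrightarrow> real_distribution (G' k)"
      "\<And>k. k \<in> {1..K} \<Longrightarrow> weak_conv_m (\<lambda>n. G (s n) k) (G' k)"
    unfolding P_def by metis
  define w' \<mu>' a' b' where "w' k = lim (\<lambda>n. w (s n) k)" and "\<mu>' k = lim (\<lambda>n. \<mu> (s n) k)"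
    and "a' k = lim (\<lambda>n. a (s n) k)" and "b' k = lim (\<lambda>n. b (s n) k)" for k
  have lim: "(\<lambda>n. w (s n) k) \<longlonglongrightarrow> w' k" "(\<lambda>n. \<mu> (s n) k) \<longlonglongrightarrow> \<mu>' k"
    "(\<lambda>n. a (s n) k) \<longlonglongrightarrow> a' k" "(\<lambda>n. b (s n) k) \<longlonglongrightarrow> b' k" if "k \<in> {1..K}" for k
    using s(2)[OF that] by (simp_all add: P_def w'_def \<mu>'_def a'_def b'_def convergent_LIMSEQ_iff)
  have 1: "m \<le> w' k \<and> \<bar>\<mu>' k\<bar> \<le> B \<and> real_distribution (G' k) \<and> -B \<le> a' k \<and> a' k \<le> b' k \<and> b' k \<le> B \<and>
      (AE t in G' k. t \<in> {a' k..b' k}) \<and> (LINT t|G' k. t) = 0" if k: "k \<in> {1..K}" for k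
  proof -
    have *: "m \<le> w' k" "\<bar>\<mu>' k\<bar> \<le> B" "-B \<le> a' k" "a' k \<le> b' k" "b' k \<le> B"
      using lim[OF k] bds[OF k]
      by (auto intro: LIMSEQ_le_const LIMSEQ_le_const2 LIMSEQ_le tendsto_rabs)
    have AE: "AE t in G' k. t \<in> {a' k..b' k}"
      by (rule weak_conv_AE_interval[OF G(1)[OF k] G'(1,2)[OF k] G(2)[OF k] lim(3,4)[OF k]])
    have "AE t in G' k. \<bar>t\<bar> \<le> B"
      by (rule eventually_mono[OF AE]) (use * in auto)
    from weak_conv_tendsto_mean[OF G(1)[OF k] G'(1,2)[OF k] B[OF k] this]
    have "(\<lambda>n. LINT t|G (s n) k. t) \<longlonglongrightarrow> (LINT t|G' k. t)" .
    moreover have "(LINT t|G (s n) k. t) = 0" for n by (rule admissibleD(8)[OF adm k])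
    ultimately have "(LINT t|G' k. t) = 0" by (simp add: LIMSEQ_const_iff)
    with * AE G'(1)[OF k] show ?thesis by simp
  qed
  have "(\<lambda>n. \<Sum>k=1..K. w (s n) k) \<longlonglongrightarrow> (\<Sum>k=1..K. w' k)"
    using lim(1) by (intro tendsto_sum) auto
  moreover have "(\<Sum>k=1..K. w (s n) k) = 1" for n by (rule admissible_sum[OF adm])
  ultimately have 2: "(\<Sum>k=1..K. w' k) = 1" by (simp add: LIMSEQ_const_iff)
  have 3: "b' l - a' l + c \<le> (a' k + \<mu>' k) - (b' j + \<mu>' j)"
    if "j \<in> {1..K}" "k \<in> {1..K}" "l \<in> {1..K}" "j < k" for j k l
  proof (rule LIMSEQ_le)
    show "(\<lambda>n. b (s n) l - a (s n) l + c) \<longlonglongrightarrow> b' l - a' l + c"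
      using that lim by (intro tendsto_intros) auto
    show "(\<lambda>n. (a (s n) k + \<mu> (s n) k) - (b (s n) j + \<mu> (s n) j)) \<longlonglongrightarrow> (a' k + \<mu>' k) - (b' j + \<mu>' j)"
      using that lim by (intro tendsto_intros) auto
    show "\<exists>N. \<forall>n\<ge>N. b (s n) l - a (s n) l + c \<le> (a (s n) k + \<mu> (s n) k) - (b (s n) j + \<mu> (s n) j)"
      using admissible_gap[OF adm that] by blast
  qed
  have "admissible K B m c w' \<mu>' G' a' b'"
    using 1 2 3 unfolding admissible_def by blast
  with s(1) lim G'(2) show ?thesis by blast
qed

text \<open>The characteristic function of the mixing measure \<open>H\<close> of the sample
  density; the phase factor is the translation by \<open>\<mu> k\<close>. As an explicit sum it can
  be passed to the limit term by term.\<close>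

definition mixture_char :: "nat \<Rightarrow> (nat \<Rightarrow> real) \<Rightarrow> (nat \<Rightarrow> real) \<Rightarrow> (nat \<Rightarrow> real measure) \<Rightarrow> real \<Rightarrow> complex" where
  "mixture_char K w \<mu> G t = (\<Sum>k=1..K. w k *\<^sub>R (iexp (t * \<mu> k) * char (G k) t))"

lemma real_distribution_translate:
  assumes "real_distribution G"
  shows "real_distribution (translate G m)"
proof -
  interpret real_distribution G by fact
  show ?thesis unfolding translate_def by (intro real_distribution_distr) auto
qed

lemma char_translate:
  assumes "real_distribution G"
  shows "char (translate G m) t = iexp (t * m) * char G t"
proof -
  interpret real_distribution G by fact
  have "char (translate G m) t = (CLINT x|G. iexp (t * (x + m)))"
    unfolding char_def translate_def by (subst integral_distr) auto
  also have "\<dots> = (CLINT x|G. iexp (t * m) * iexp (t * x))"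
    by (intro Bochner_Integration.integral_cong) (auto simp: exp_add[symmetric] algebra_simps)
  also have "\<dots> = iexp (t * m) * char G t"
    unfolding char_def by (simp only: integral_mult_right_zero)
  finally show ?thesis .
qed

text \<open>Levy's uniqueness theorem turns equal characteristic functions into equal mixtures of
  translated components, to which \<open>ordered_mixture_unique\<close> applies.\<close>

lemma admissible_mixture_char_inj:
  assumes adm: "admissible K B m c w \<mu> G a b" and adm': "admissible K B m c w' \<mu>' G' a' b'"
    and pos: "0 < m" "0 < c" and eq: "mixture_char K w \<mu> G = mixture_char K w' \<mu>' G'"
    and k: "k \<in> {1..K}"
  shows "w k = w' k" "G k = G' k"
proof -
  let ?T = "\<lambda>G \<mu> k. translate (G k :: real measure) (\<mu> k)"
  have fact: "real_distribution (?T G \<mu> k)" "0 < w k" "AE t in ?T G \<mu> k. t \<in> {a k + \<mu> k..b k + \<mu> k}"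
    "(LINT t|?T G \<mu> k. t) = \<mu> k" "G k = translate (?T G \<mu> k) (- \<mu> k)"
    if adm: "admissible K B m c w \<mu> G a b" and k: "k \<in> {1..K}" for w \<mu> a b :: "nat \<Rightarrow> real" and G k
  proof -
    note ad = admissibleD[OF adm k]
    show "0 < w k" using ad(1) pos by simp
    note G = ad(3)
    then interpret real_distribution "G k" .
    show "real_distribution (?T G \<mu> k)" by (rule real_distribution_translate[OF G])
    from ad(7) show "AE t in ?T G \<mu> k. t \<in> {a k + \<mu> k..b k + \<mu> k}"
      unfolding translate_def by (subst AE_distr_iff) auto
    have "integrable (G k) (\<lambda>t. t)"
      by (rule integrable_const_bound[where B=B]) (use admissible_abs_le[OF adm k] in auto)
    then have "(LINT t|G k. t + \<mu> k) = \<mu> k"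
      using ad(8) by (simp add: prob_space del: space_eq_univ)
    then show "(LINT t|?T G \<mu> k. t) = \<mu> k" unfolding translate_def by (subst integral_distr) auto
    show "G k = translate (?T G \<mu> k) (- \<mu> k)"
      unfolding translate_def by (subst distr_distr) (auto simp: o_def distr_id2)
  qed
  note f = fact[OF adm] and f' = fact[OF adm']
  have sums: "(\<Sum>k=1..K. w k) = 1" "(\<Sum>k=1..K. w' k) = 1"
    by (rule admissible_sum[OF adm], rule admissible_sum[OF adm'])
  obtain H where H: "real_distribution H"
    "\<And>A. A \<in> sets borel \<Longrightarrow> measure H A = (\<Sum>k=1..K. w k * measure (?T G \<mu> k) A)"
    "\<And>t. char H t = (\<Sum>k=1..K. w k *\<^sub>R char (?T G \<mu> k) t)"
    by (rule ex_finite_mixture[of "{1..K}" w "?T G \<mu>"]) (use f sums in \<open>auto simp: less_imp_le\<close>)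
  obtain H' where H': "real_distribution H'"
    "\<And>A. A \<in> sets borel \<Longrightarrow> measure H' A = (\<Sum>k=1..K. w' k * measure (?T G' \<mu>' k) A)"
    "\<And>t. char H' t = (\<Sum>k=1..K. w' k *\<^sub>R char (?T G' \<mu>' k) t)"
    by (rule ex_finite_mixture[of "{1..K}" w' "?T G' \<mu>'"]) (use f' sums in \<open>auto simp: less_imp_le\<close>)
  have "char H t = mixture_char K w \<mu> G t" "char H' t = mixture_char K w' \<mu>' G' t" for t
    unfolding H(3) H'(3) mixture_char_def using admissibleD(3)[OF adm] admissibleD(3)[OF adm']
    by (auto intro!: sum.cong simp: char_translate)
  then have "char H = char H'" using eq by auto
  then have "H = H'" by (intro Levy_uniqueness H H')
  then have meq: "(\<Sum>k=1..K. w k * measure (?T G \<mu> k) A) = (\<Sum>k=1..K. w' k * measure (?T G' \<mu>' k) A)"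
    if "A \<in> sets borel" for A
    using H(2)[OF that] H'(2)[OF that] by simp
  define D where "D = Max ((\<lambda>l. b l - a l) ` {1..K})"
  define D' where "D' = Max ((\<lambda>l. b' l - a' l) ` {1..K})"
  have D: "b l - a l \<le> D" "b' l - a' l \<le> D'" if "l \<in> {1..K}" for l
    using that by (auto simp: D_def D'_def)
  have sep: "D + c \<le> (a k + \<mu> k) - (b j + \<mu> j)" if jk: "j \<in> {1..K}" "k \<in> {1..K}" "j < k" for j k
  proof -
    have "D \<in> (\<lambda>l. b l - a l) ` {1..K}" unfolding D_def using jk by (intro Max_in) auto
    then obtain l where "l \<in> {1..K}" "D = b l - a l" by auto
    then show ?thesis using admissible_gap[OF adm jk(1,2) _ jk(3), of l] by simp
  qed
  have sep': "D' + c \<le> (a' k + \<mu>' k) - (b' j + \<mu>' j)" if jk: "j \<in> {1..K}" "k \<in> {1..K}" "j < k" for j k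
  proof -
    have "D' \<in> (\<lambda>l. b' l - a' l) ` {1..K}" unfolding D'_def using jk by (intro Max_in) auto
    then obtain l where "l \<in> {1..K}" "D' = b' l - a' l" by auto
    then show ?thesis using admissible_gap[OF adm' jk(1,2) _ jk(3), of l] by simp
  qed
  have nn: "0 \<le> D" "0 \<le> D'"
    using D[OF k] admissibleD(5)[OF adm k] admissibleD(5)[OF adm' k] by linarith+
  \<comment> \<open>The family containing the longest interval is the one whose gaps exceed every interval length.\<close>
  have "w k = w' k \<and> ?T G \<mu> k = ?T G' \<mu>' k"
  proof (cases "D' \<le> D")
    case True
    show ?thesis
    proof (rule ordered_mixture_unique[where K=K and \<nu>="?T G \<mu>" and \<nu>'="?T G' \<mu>'" and w=w and w'=w'
          and a="\<lambda>k. a k + \<mu> k" and b="\<lambda>k. b k + \<mu> k" and a'="\<lambda>k. a' k + \<mu>' k" and b'="\<lambda>k. b' k + \<mu>' k"])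
      show "b' l + \<mu>' l - (a' l + \<mu>' l) < a k + \<mu> k - (b j + \<mu> j)"
        if "j \<in> {1..K}" "k \<in> {1..K}" "l \<in> {1..K}" "j < k" for j k l
        using sep[of j k] that D[of l] True pos by auto
      show "b' j + \<mu>' j < a' k + \<mu>' k" if "j \<in> {1..K}" "k \<in> {1..K}" "j < k" for j k
        using sep'[of j k] that nn pos by auto
    qed (use f(1-3) f'(1-3) meq k in simp_all)
  next
    case False
    have "w' k = w k \<and> ?T G' \<mu>' k = ?T G \<mu> k"
    proof (rule ordered_mixture_unique[where K=K and \<nu>'="?T G \<mu>" and \<nu>="?T G' \<mu>'" and w'=w and w=w'
          and a'="\<lambda>k. a k + \<mu> k" and b'="\<lambda>k. b k + \<mu> k" and a="\<lambda>k. a' k + \<mu>' k" and b="\<lambda>k. b' k + \<mu>' k"])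
      show "b l + \<mu> l - (a l + \<mu> l) < a' k + \<mu>' k - (b' j + \<mu>' j)"
        if "j \<in> {1..K}" "k \<in> {1..K}" "l \<in> {1..K}" "j < k" for j k l
        using sep'[of j k] that D[of l] False pos by auto
      show "b j + \<mu> j < a k + \<mu> k" if "j \<in> {1..K}" "k \<in> {1..K}" "j < k" for j k
        using sep[of j k] that nn pos by auto
    qed (use f(1-3) f'(1-3) meq k in simp_all)
    then show ?thesis by simp
  qed
  \<comment> \<open>Equal translated laws have equal means, that is, equal shifts; translating back
    by the common shift identifies the mixing measures.\<close>
  then show "w k = w' k" "G k = G' k"
    using f(4,5)[OF k] f'(4,5)[OF k] by metis+
qed

lemma mixture_char_tendsto:
  assumes "\<And>n k. k \<in> {1..K} \<Longrightarrow> real_distribution (G n k)" "\<And>k. k \<in> {1..K} \<Longrightarrow> real_distribution (G' k)"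
    "\<And>k. k \<in> {1..K} \<Longrightarrow> (\<lambda>n. w n k) \<longlonglongrightarrow> w' k" "\<And>k. k \<in> {1..K} \<Longrightarrow> (\<lambda>n. \<mu> n k) \<longlonglongrightarrow> \<mu>' k"
    "\<And>k. k \<in> {1..K} \<Longrightarrow> weak_conv_m (\<lambda>n. G n k) (G' k)"
  shows "(\<lambda>n. mixture_char K (w n) (\<mu> n) (G n) t) \<longlonglongrightarrow> mixture_char K w' \<mu>' G' t"
  unfolding mixture_char_def
  using assms by (intro tendsto_intros levy_continuity1) auto

lemma isCont_mixture_char:
  assumes "\<And>k. k \<in> {1..K} \<Longrightarrow> real_distribution (G k)"
  shows "isCont (mixture_char K w \<mu> G) t"
  unfolding mixture_char_def
  using assms by (intro continuous_intros real_distribution.isCont_char) auto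

lemma L1_norm_triangle:
  assumes "integrable lborel f" "integrable lborel g" "integrable lborel h"
  shows "L1_norm (\<lambda>x. f x - g x) \<le> L1_norm (\<lambda>x. f x - h x) + L1_norm (\<lambda>x. g x - h x)"
proof -
  have "L1_norm (\<lambda>x. f x - g x) \<le> (LINT x|lborel. \<bar>f x - h x\<bar> + \<bar>g x - h x\<bar>)"
    unfolding L1_norm_def using assms by (intro integral_mono) auto
  also have "\<dots> = L1_norm (\<lambda>x. f x - h x) + L1_norm (\<lambda>x. g x - h x)"
    unfolding L1_norm_def using assms by (intro Bochner_Integration.integral_add) auto
  finally show ?thesis .
qed

text \<open>Both sequences converge along a common subsequence to admissible limits. The limiting
  characteristic functions agree on the rationals, hence everywhere by continuity, so the limits
  have the same components. A subsequence is enough for the contradiction in which this is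
  used.\<close>

lemma tendsto_components_if_chars_close:
  fixes w \<mu> a b w' \<mu>' a' b' :: "nat \<Rightarrow> nat \<Rightarrow> real" and G G' :: "nat \<Rightarrow> nat \<Rightarrow> real measure"
  assumes adm: "\<And>n. admissible K B m c (w n) (\<mu> n) (G n) (a n) (b n)"
    and adm': "\<And>n. admissible K B m c (w' n) (\<mu>' n) (G' n) (a' n) (b' n)"
    and pos: "0 < m" "0 < c" "0 < \<sigma>"
    and char: "\<And>t. t \<in> \<rat> \<Longrightarrow>
      (\<lambda>n. mixture_char K (w n) (\<mu> n) (G n) t - mixture_char K (w' n) (\<mu>' n) (G' n) t) \<longlonglongrightarrow> 0"
  shows "\<exists>r. strict_mono (r :: nat \<Rightarrow> nat) \<and> (\<forall>k\<in>{1..K}. (\<lambda>n. w (r n) k - w' (r n) k) \<longlonglongrightarrow> 0 \<and>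
    (\<lambda>n. L1_norm (\<lambda>x. gauss_conv \<sigma> (G (r n) k) x - gauss_conv \<sigma> (G' (r n) k) x)) \<longlonglongrightarrow> 0)"
proof -
  obtain r u \<alpha> A p q where r: "strict_mono (r :: nat \<Rightarrow> nat)" and A: "admissible K B m c u \<alpha> A p q"
    and lim: "\<And>k. k \<in> {1..K} \<Longrightarrow> (\<lambda>n. w (r n) k) \<longlonglongrightarrow> u k" "\<And>k. k \<in> {1..K} \<Longrightarrow> (\<lambda>n. \<mu> (r n) k) \<longlonglongrightarrow> \<alpha> k"
      "\<And>k. k \<in> {1..K} \<Longrightarrow> weak_conv_m (\<lambda>n. G (r n) k) (A k)"
    using admissible_compact[of K B m c w \<mu> G a b, OF adm pos(1)] by blast
  obtain s u' \<alpha>' A' p' q' where s: "strict_mono (s :: nat \<Rightarrow> nat)" and A': "admissible K B m c u' \<alpha>' A' p' q'"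
    and lim': "\<And>k. k \<in> {1..K} \<Longrightarrow> (\<lambda>n. w' (r (s n)) k) \<longlonglongrightarrow> u' k"
      "\<And>k. k \<in> {1..K} \<Longrightarrow> (\<lambda>n. \<mu>' (r (s n)) k) \<longlonglongrightarrow> \<alpha>' k"
      "\<And>k. k \<in> {1..K} \<Longrightarrow> weak_conv_m (\<lambda>n. G' (r (s n)) k) (A' k)"
    using admissible_compact[of K B m c "\<lambda>n. w' (r n)" "\<lambda>n. \<mu>' (r n)" "\<lambda>n. G' (r n)" "\<lambda>n. a' (r n)" "\<lambda>n. b' (r n)",
        OF adm' pos(1)] by blast
  define v where "v n = r (s n)" for n
  have v: "strict_mono v" using r s by (simp add: v_def strict_mono_def)
  have L: "(\<lambda>n. w (v n) k) \<longlonglongrightarrow> u k" "(\<lambda>n. \<mu> (v n) k) \<longlonglongrightarrow> \<alpha> k" "weak_conv_m (\<lambda>n. G (v n) k) (A k)"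
    if "k \<in> {1..K}" for k
    unfolding v_def using LIMSEQ_subseq_LIMSEQ[OF lim(1)[OF that] s] LIMSEQ_subseq_LIMSEQ[OF lim(2)[OF that] s]
      weak_conv_m_subseq[OF lim(3)[OF that] s] by (simp_all add: o_def)
  note L' = lim'[folded v_def]
  have D: "real_distribution (G n k)" "real_distribution (G' n k)" "real_distribution (A k)" "real_distribution (A' k)"
    if "k \<in> {1..K}" for n k
    using admissibleD(3)[OF adm that] admissibleD(3)[OF adm' that] admissibleD(3)[OF A that]
      admissibleD(3)[OF A' that] by auto
  have "mixture_char K u \<alpha> A t = mixture_char K u' \<alpha>' A' t" if t: "t \<in> \<rat>" for t
  proof -
    have "(\<lambda>n. mixture_char K (w (v n)) (\<mu> (v n)) (G (v n)) t - mixture_char K (w' (v n)) (\<mu>' (v n)) (G' (v n)) t)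
       \<longlonglongrightarrow> mixture_char K u \<alpha> A t - mixture_char K u' \<alpha>' A' t"
      using L L' D by (intro tendsto_diff mixture_char_tendsto) auto
    moreover have "(\<lambda>n. mixture_char K (w (v n)) (\<mu> (v n)) (G (v n)) t - mixture_char K (w' (v n)) (\<mu>' (v n)) (G' (v n)) t)
       \<longlonglongrightarrow> 0"
      using LIMSEQ_subseq_LIMSEQ[OF char[OF t] v] by (simp add: o_def)
    ultimately show ?thesis using LIMSEQ_unique by fastforce
  qed
  note rat = this
  define d where "d t = mixture_char K u \<alpha> A t - mixture_char K u' \<alpha>' A' t" for t
  have "isCont (mixture_char K u \<alpha> A) t" "isCont (mixture_char K u' \<alpha>' A') t" for t
    by (rule isCont_mixture_char, erule D(3), rule isCont_mixture_char, erule D(4))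
  then have "continuous_on (closure \<rat>) d"
    unfolding d_def by (intro continuous_at_imp_continuous_on ballI continuous_diff) auto
  moreover have "d t = 0" if "t \<in> \<rat>" for t
    unfolding d_def rat[OF that] by simp
  ultimately have "d t = 0" for t
    using continuous_constant_on_closure[of \<rat> d 0 t] by (simp add: Rats_closure_real)
  then have "mixture_char K u \<alpha> A = mixture_char K u' \<alpha>' A'" by (auto simp: d_def)
  note uniq = admissible_mixture_char_inj[OF A A' pos(1,2) this]
  have "(\<lambda>n. w (v n) k - w' (v n) k) \<longlonglongrightarrow> 0" if k: "k \<in> {1..K}" for k
    using tendsto_diff[OF L(1)[OF k] L'(1)[OF k]] uniq(1)[OF k] by simp
  moreover have "(\<lambda>n. L1_norm (\<lambda>x. gauss_conv \<sigma> (G (v n) k) x - gauss_conv \<sigma> (G' (v n) k) x)) \<longlonglongrightarrow> 0"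
    if k: "k \<in> {1..K}" for k
  proof (rule tendsto_sandwich[OF always_eventually always_eventually tendsto_const])
    let ?N = "\<lambda>M n. L1_norm (\<lambda>x. gauss_conv \<sigma> (M (v n) k) x - gauss_conv \<sigma> (A k) x)"
    have "?N G \<longlonglongrightarrow> 0" "?N G' \<longlonglongrightarrow> 0"
      using tendsto_L1_gauss_conv[OF pos(3) D(1)[OF k] D(3)[OF k] L(3)[OF k]]
        tendsto_L1_gauss_conv[OF pos(3) D(2)[OF k] D(4)[OF k] L'(3)[OF k]] uniq(2)[OF k] by auto
    from tendsto_add[OF this] show "(\<lambda>n. ?N G n + ?N G' n) \<longlonglongrightarrow> 0" by simp
    have int: "integrable lborel (gauss_conv \<sigma> M)" if "real_distribution M" for M
      using has_bochner_integral_gauss_conv[OF pos(3) that] by (simp add: has_bochner_integral_iff)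
    show "\<forall>n. L1_norm (\<lambda>x. gauss_conv \<sigma> (G (v n) k) x - gauss_conv \<sigma> (G' (v n) k) x) \<le> ?N G n + ?N G' n"
      by (intro allI L1_norm_triangle int D k)
  qed (simp add: L1_norm_def)
  ultimately show ?thesis using v by blast
qed

subsection \<open>Uniformly consistent estimation over a finite net\<close>

text \<open>The point is that the bound depends on \<open>n\<close> and \<open>\<eta>\<close> alone,
  so it is uniform over all laws \<open>P\<close>.\<close>

lemma Hoeffding_empirical_mean:
  fixes h :: "real \<Rightarrow> real" and n :: nat and \<eta> :: real
  assumes P: "prob_space P" "sets P = sets borel" and [measurable]: "h \<in> borel_measurable borel"
    and bd: "\<And>x. \<bar>h x\<bar> \<le> 1" and n: "n \<ge> 1" and \<eta>: "\<eta> > 0"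
  defines "S \<equiv> \<Pi>\<^sub>M i\<in>{1..n}. P"
  shows "{s \<in> space S. \<eta> \<le> \<bar>(\<Sum>i=1..n. h (s i)) / n - (LINT x|P. h x)\<bar>} \<in> sets S"
    "measure S {s \<in> space S. \<eta> \<le> \<bar>(\<Sum>i=1..n. h (s i)) / n - (LINT x|P. h x)\<bar>} \<le> 2 * exp (- (n * \<eta>\<^sup>2 / 2))"
proof -
  note [measurable_cong] = P(2)
  show "{s \<in> space S. \<eta> \<le> \<bar>(\<Sum>i=1..n. h (s i)) / n - (LINT x|P. h x)\<bar>} \<in> sets S"
    unfolding S_def by measurable
  have hP: "h \<in> borel_measurable P" by measurable
  interpret P: prob_space P by fact
  interpret S: product_prob_space "\<lambda>_. P" "{1..n}" by unfold_locales
  have pS: "prob_space S" unfolding S_def by (rule prob_space_PiM) (rule P(1))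
  \<comment> \<open>Coordinates of a product measure are independent because their joint law, the
    product itself, is the product of their marginals.\<close>
  have ind: "prob_space.indep_vars S (\<lambda>_. P) (\<lambda>i s. s i) {1..n}"
  proof -
    interpret prob_space S by fact
    have comp: "distr S P (\<lambda>s. s i) = P" if "i \<in> {1..n}" for i
      unfolding S_def using that by (rule S.PiM_component)
    have "distr S (\<Pi>\<^sub>M i\<in>{1..n}. P) (\<lambda>s. \<lambda>i\<in>{1..n}. s i) = distr S S (\<lambda>s. s)"
      unfolding S_def by (intro distr_cong refl) (auto simp: space_PiM PiE_restrict)
    also have "\<dots> = S" by (rule distr_id)
    also have "\<dots> = (\<Pi>\<^sub>M i\<in>{1..n}. distr S P (\<lambda>s. s i))"
      unfolding S_def by (intro PiM_cong refl) (use comp in \<open>auto simp: S_def\<close>)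
    finally show ?thesis
      using n by (subst indep_vars_iff_distr_eq_PiM') (auto simp: S_def)
  qed
  have ex: "(LINT s|S. h (s i)) = (LINT x|P. h x)" if "i \<in> {1..n}" for i
  proof -
    have "(LINT s|S. h (s i)) = (LINT x|distr S P (\<lambda>s. s i). h x)"
      using that unfolding S_def by (subst integral_distr) auto
    also have "distr S P (\<lambda>s. s i) = P" unfolding S_def using that S.PiM_component by auto
    finally show ?thesis .
  qed
  interpret Hoeffding_ineq S "{1..n}" "\<lambda>i s. h (s i)" "\<lambda>_. -1" "\<lambda>_. 1" "\<Sum>i\<in>{1..n}. (LINT s|S. h (s i))"
  proof -
    interpret prob_space S by fact
    show "Hoeffding_ineq S {1..n} (\<lambda>i s. h (s i)) (\<lambda>_. - 1) (\<lambda>_. 1)"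
    proof
      show "indep_vars (\<lambda>_. borel) (\<lambda>i s. h (s i)) {1..n}"
        by (rule indep_vars_compose2[OF ind]) auto
      show "AE x in S. h (x i) \<in> {- 1..1}" if "i \<in> {1..n}" for i
        using bd by (auto simp: abs_le_iff minus_le_iff)
    qed simp
  qed simp
  have "{s \<in> space S. \<eta> \<le> \<bar>(\<Sum>i=1..n. h (s i)) / n - (LINT x|P. h x)\<bar>} =
      {s \<in> space S. n * \<eta> \<le> \<bar>(\<Sum>i=1..n. h (s i)) - (\<Sum>i=1..n. (LINT s|S. h (s i)))\<bar>}"
  proof (intro Collect_cong conj_cong refl)
    fix s
    have "\<bar>(\<Sum>i=1..n. h (s i)) - (\<Sum>i=1..n. (LINT s|S. h (s i)))\<bar> =
        n * \<bar>(\<Sum>i=1..n. h (s i)) / n - (LINT x|P. h x)\<bar>"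
    proof -
      have "(\<Sum>i=1..n. (LINT s|S. h (s i))) = n * (LINT x|P. h x)"
        using ex by simp
      then have "(\<Sum>i=1..n. h (s i)) - (\<Sum>i=1..n. (LINT s|S. h (s i))) =
          n * ((\<Sum>i=1..n. h (s i)) / n - (LINT x|P. h x))"
        using n by (simp add: right_diff_distrib)
      then show ?thesis by (simp only: abs_mult abs_of_nat)
    qed
    then show "\<eta> \<le> \<bar>(\<Sum>i=1..n. h (s i)) / n - (LINT x|P. h x)\<bar> \<longleftrightarrow>
      n * \<eta> \<le> \<bar>(\<Sum>i=1..n. h (s i)) - (\<Sum>i=1..n. (LINT s|S. h (s i)))\<bar>"
      using n by simp
  qed
  moreover have "measure S {s \<in> space S. n * \<eta> \<le> \<bar>(\<Sum>i=1..n. h (s i)) - (\<Sum>i=1..n. (LINT s|S. h (s i)))\<bar>} \<le>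
     2 * exp (- 2 * (n * \<eta>)\<^sup>2 / (\<Sum>i\<in>{1..n}. (1 - (-1))\<^sup>2))"
    by (rule Hoeffding_ineq_abs_ge) (use n \<eta> in auto)
  \<comment> \<open>Each variable ranges over an interval of length 2, so the squared lengths add up
    to \<open>4 * n\<close>.\<close>
  moreover have "- 2 * (n * \<eta>)\<^sup>2 / (\<Sum>i\<in>{1..n}. (1 - (-1))\<^sup>2) = - (n * \<eta>\<^sup>2 / 2)"
    using n by (simp add: power2_eq_square field_simps)
  ultimately show "measure S {s \<in> space S. \<eta> \<le> \<bar>(\<Sum>i=1..n. h (s i)) / n - (LINT x|P. h x)\<bar>} \<le> 2 * exp (- (n * \<eta>\<^sup>2 / 2))"
    by (simp only:)
qed

text \<open>Parameters are grouped by the grid cell of side \<open>\<eta>\<close> containing their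
  first \<open>J\<close> moments. Boundedness leaves finitely many cells, and one representative is
  kept for each occupied cell, so the net consists of genuine parameters.\<close>

lemma ex_finite_net:
  fixes E :: "'p \<Rightarrow> nat \<Rightarrow> real"
  assumes bd: "\<And>\<theta> j. \<theta> \<in> U \<Longrightarrow> \<bar>E \<theta> j\<bar> \<le> 1" and \<eta>: "\<eta> > 0"
  obtains F where "finite F" "F \<subseteq> U" "\<And>\<theta>. \<theta> \<in> U \<Longrightarrow> \<exists>\<theta>'\<in>F. \<forall>j<J. \<bar>E \<theta> j - E \<theta>' j\<bar> < \<eta>"
proof -
  define cell where "cell \<theta> = (\<lambda>j\<in>{..<J}. \<lfloor>E \<theta> j / \<eta>\<rfloor>)" for \<theta>
  define c where "c = \<lceil>1 / \<eta>\<rceil>"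
  have "cell \<theta> \<in> {..<J} \<rightarrow>\<^sub>E {-c..c}" if "\<theta> \<in> U" for \<theta>
  proof -
    have "\<lfloor>E \<theta> j / \<eta>\<rfloor> \<in> {-c..c}" for j
    proof -
      have b: "-(1/\<eta>) \<le> E \<theta> j / \<eta>" "E \<theta> j / \<eta> \<le> 1 / \<eta>"
        using bd[OF that, of j] \<eta> by (auto simp: field_simps abs_le_iff)
      have "- c \<le> \<lfloor>E \<theta> j / \<eta>\<rfloor>"
        unfolding c_def using floor_mono[OF b(1)] by (simp add: floor_minus)
      moreover have "\<lfloor>E \<theta> j / \<eta>\<rfloor> \<le> c"
        unfolding c_def using floor_mono[OF b(2)] floor_le_ceiling[of "1/\<eta>"] by linarith
      ultimately show ?thesis by simp
    qed
    then show ?thesis unfolding cell_def by auto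
  qed
  then have "cell ` U \<subseteq> {..<J} \<rightarrow>\<^sub>E {-c..c}" by blast
  then have fin: "finite (cell ` U)" by (rule finite_subset) (auto intro: finite_PiE)
  define rep where "rep v = (SOME \<theta>. \<theta> \<in> U \<and> cell \<theta> = v)" for v
  have rep: "rep (cell \<theta>) \<in> U" "cell (rep (cell \<theta>)) = cell \<theta>" if "\<theta> \<in> U" for \<theta>
    using someI[of "\<lambda>\<theta>'. \<theta>' \<in> U \<and> cell \<theta>' = cell \<theta>" \<theta>] that by (auto simp: rep_def)
  show thesis
  proof (rule that[of "rep ` cell ` U"])
    show "\<exists>\<theta>'\<in>rep ` cell ` U. \<forall>j<J. \<bar>E \<theta> j - E \<theta>' j\<bar> < \<eta>" if "\<theta> \<in> U" for \<theta>
    proof (rule bexI[of _ "rep (cell \<theta>)"], intro allI impI)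
      fix j assume "j < J"
      then have eq: "\<lfloor>E (rep (cell \<theta>)) j / \<eta>\<rfloor> = \<lfloor>E \<theta> j / \<eta>\<rfloor>"
        using fun_cong[OF rep(2)[OF that], of j] by (simp add: cell_def)
      have "\<bar>E \<theta> j / \<eta> - E (rep (cell \<theta>)) j / \<eta>\<bar> < 1"
        using eq by linarith
      also have "\<bar>E \<theta> j / \<eta> - E (rep (cell \<theta>)) j / \<eta>\<bar> = \<bar>E \<theta> j - E (rep (cell \<theta>)) j\<bar> / \<eta>"
        using \<eta> by (simp add: diff_divide_distrib[symmetric])
      finally show "\<bar>E \<theta> j - E (rep (cell \<theta>)) j\<bar> < \<eta>"
        using \<eta> by simp
    qed (use that in auto)
  qed (use fin rep in auto)
qed

text \<open>Scanning a fixed list makes the selection a measurable function of the sample, which an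
  arbitrary choice among matching elements would not ensure. The default \<open>d\<close> covers
  samples that match nothing.\<close>

definition first_such :: "'p \<Rightarrow> ('s \<Rightarrow> 'p \<Rightarrow> bool) \<Rightarrow> 'p list \<Rightarrow> 's \<Rightarrow> 'p" where
  "first_such d P xs s = (case find (P s) xs of None \<Rightarrow> d | Some x \<Rightarrow> x)"

lemma first_such_simps:
  "first_such d P [] s = d" "first_such d P (x # xs) s = (if P s x then x else first_such d P xs s)"
  by (simp_all add: first_such_def)

lemma first_such_in: "first_such d P xs s \<in> insert d (set xs)"
  by (induction xs) (auto simp: first_such_simps)

lemma first_such_holds: "x \<in> set xs \<Longrightarrow> P s x \<Longrightarrow> P s (first_such d P xs s)"
  by (induction xs) (auto simp: first_such_simps)

lemma measurable_first_such:
  assumes "\<And>x. x \<in> set xs \<Longrightarrow> Measurable.pred M (\<lambda>s. P s x)"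
  shows "first_such d P xs \<in> measurable M (count_space UNIV)"
  using assms
proof (induction xs)
  case Nil
  show ?case by (simp add: first_such_simps[abs_def])
next
  case (Cons x xs)
  have [measurable]: "Measurable.pred M (\<lambda>s. P s x)" "first_such d P xs \<in> measurable M (count_space UNIV)"
    using Cons by auto
  have "first_such d P (x # xs) = (\<lambda>s. if P s x then x else first_such d P xs s)"
    by (auto simp: first_such_simps)
  then show ?case by simp
qed

text \<open>How \<open>\<eta>\<close> is split: a quarter for the sampling error and a quarter for
  the net, so outside the exceptional event some net element passes the test at
  \<open>\<eta> / 2\<close>; whatever passes it is within
  \<open>\<eta> / 2 + \<eta> / 4 < \<eta>\<close> of the truth. The factor \<open>J\<close> is the
  union bound over the moments.\<close>

lemma minimum_distance_estimator:
  fixes p :: "'p \<Rightarrow> real measure" and h :: "nat \<Rightarrow> real \<Rightarrow> real" and J :: nat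
  assumes U: "U \<noteq> {}" and p: "\<And>\<theta>. \<theta> \<in> U \<Longrightarrow> prob_space (p \<theta>) \<and> sets (p \<theta>) = sets borel"
    and h[measurable]: "\<And>j. h j \<in> borel_measurable borel" and bd: "\<And>j x. \<bar>h j x\<bar> \<le> 1" and \<eta>: "\<eta> > 0"
  obtains T :: "nat \<Rightarrow> (nat \<Rightarrow> real) \<Rightarrow> 'p" where
    "\<And>n s. T n s \<in> U" "\<And>n. finite (range (T n))"
    "\<And>n. T n \<in> measurable (sample_space n) (count_space UNIV)"
    "\<And>\<theta> n. \<theta> \<in> U \<Longrightarrow> n \<ge> 1 \<Longrightarrow> \<exists>A\<in>sets (\<Pi>\<^sub>M i\<in>{1..n}. p \<theta>).
       measure (\<Pi>\<^sub>M i\<in>{1..n}. p \<theta>) A \<le> J * (2 * exp (- (n * (\<eta> / 4)\<^sup>2 / 2))) \<and>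
       (\<forall>s\<in>space (\<Pi>\<^sub>M i\<in>{1..n}. p \<theta>) - A. \<forall>j<J. \<bar>(LINT x|p (T n s). h j x) - (LINT x|p \<theta>. h j x)\<bar> < \<eta>)"
proof -
  define E where "E \<theta> j = (LINT x|p \<theta>. h j x)" for \<theta> j
  have E: "\<bar>E \<theta> j\<bar> \<le> 1" if "\<theta> \<in> U" for \<theta> j
  proof -
    interpret prob_space "p \<theta>" using p[OF that] by simp
    have "h j \<in> borel_measurable (p \<theta>)" using p[OF that] by (simp cong: measurable_cong_sets)
    then have i: "integrable (p \<theta>) (h j)"
      by (intro integrable_const_bound[where B=1]) (use bd in auto)
    have "E \<theta> j \<le> 1" "-1 \<le> E \<theta> j"
      unfolding E_def using bd[of j]
      by (intro integral_le_const integral_ge_const i; simp add: abs_le_iff minus_le_iff)+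
    then show ?thesis by (simp add: abs_le_iff)
  qed
  obtain F where F: "finite F" "F \<subseteq> U" "\<And>\<theta>. \<theta> \<in> U \<Longrightarrow> \<exists>\<theta>'\<in>F. \<forall>j<J. \<bar>E \<theta> j - E \<theta>' j\<bar> < \<eta> / 4"
    using ex_finite_net[where U=U and E=E and \<eta>="\<eta> / 4" and J=J] E \<eta> by auto
  obtain xs where xs: "set xs = F" using F(1) finite_list by blast
  obtain d where d: "d \<in> U" using U by blast
  define P where "P n s \<theta> \<longleftrightarrow> (\<forall>j<J. \<bar>(\<Sum>i=1..n. h j (s i)) / n - E \<theta> j\<bar> < \<eta> / 2)" for n :: nat and s \<theta>
  define T where "T n = first_such d (P n) xs" for n
  show thesis
  proof (rule that[of T])
    show "T n s \<in> U" for n s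
      using first_such_in[of d "P n" xs s] xs F(2) d by (auto simp: T_def)
    have "range (T n) \<subseteq> insert d F" for n
      using first_such_in[of d "P n" xs] xs by (auto simp: T_def)
    then show "finite (range (T n))" for n
      by (rule finite_subset) (simp add: F(1))
    show "T n \<in> measurable (sample_space n) (count_space UNIV)" for n
    proof -
      have "(\<lambda>s. (\<Sum>i=1..n. h j (s i)) / n) \<in> borel_measurable (sample_space n)" for j
        by measurable
      then have "Measurable.pred (sample_space n) (\<lambda>s. P n s x)" for x
        unfolding P_def by measurable
      then show ?thesis unfolding T_def by (rule measurable_first_such)
    qed
    fix \<theta> and n :: nat assume \<theta>: "\<theta> \<in> U" and n: "n \<ge> 1"
    let ?S = "\<Pi>\<^sub>M i\<in>{1..n}. p \<theta>"
    define A where "A j = {s \<in> space ?S. \<eta> / 4 \<le> \<bar>(\<Sum>i=1..n. h j (s i)) / n - E \<theta> j\<bar>}" for j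
    have "prob_space (p \<theta>)" "sets (p \<theta>) = sets borel" using p[OF \<theta>] by auto
    note A = Hoeffding_empirical_mean[OF this h bd n, where \<eta>="\<eta> / 4", folded E_def, folded A_def]
    interpret S: prob_space ?S using p[OF \<theta>] by (intro prob_space_PiM) auto
    show "\<exists>A\<in>sets ?S. measure ?S A \<le> J * (2 * exp (- (n * (\<eta> / 4)\<^sup>2 / 2))) \<and>
       (\<forall>s\<in>space ?S - A. \<forall>j<J. \<bar>(LINT x|p (T n s). h j x) - (LINT x|p \<theta>. h j x)\<bar> < \<eta>)"
    proof (intro bexI[of _ "\<Union>j<J. A j"] conjI ballI allI impI)
      have "measure ?S (\<Union>j<J. A j) \<le> (\<Sum>j<J. measure ?S (A j))"
        using A(1) \<eta> by (intro measure_UNION_le) auto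
      also have "\<dots> \<le> (\<Sum>j<J. 2 * exp (- (n * (\<eta> / 4)\<^sup>2 / 2)))"
        using A(2) \<eta> by (intro sum_mono) auto
      finally show "measure ?S (\<Union>j<J. A j) \<le> J * (2 * exp (- (n * (\<eta> / 4)\<^sup>2 / 2)))" by simp
      fix s j assume s: "s \<in> space ?S - (\<Union>j<J. A j)" and j: "j < J"
      then have emp: "\<bar>(\<Sum>i=1..n. h i' (s i)) / n - E \<theta> i'\<bar> < \<eta> / 4" if "i' < J" for i'
        using that by (auto simp: A_def not_le)
      obtain \<theta>' where \<theta>': "\<theta>' \<in> F" "\<And>j. j < J \<Longrightarrow> \<bar>E \<theta> j - E \<theta>' j\<bar> < \<eta> / 4"
        using F(3)[OF \<theta>] by blast
      have "P n s \<theta>'"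
        unfolding P_def
      proof (intro allI impI)
        fix i assume "i < J"
        from emp[OF this] \<theta>'(2)[OF this] show "\<bar>(\<Sum>l=1..n. h i (s l)) / n - E \<theta>' i\<bar> < \<eta> / 2"
          by linarith
      qed
      then have "P n s (T n s)"
        unfolding T_def using first_such_holds \<theta>'(1) xs by metis
      then have "\<bar>(\<Sum>i=1..n. h j (s i)) / n - E (T n s) j\<bar> < \<eta> / 2"
        unfolding P_def using j by blast
      with emp[OF j] have "\<bar>E (T n s) j - E \<theta> j\<bar> < \<eta>"
        using \<eta> by linarith
      then show "\<bar>(LINT x|p (T n s). h j x) - (LINT x|p \<theta>. h j x)\<bar> < \<eta>"
        unfolding E_def .
    qed (use A(1) \<eta> in auto)
  qed
qed

text \<open>\<open>M n\<close> is the largest index \<open>m \<le> n\<close> whose threshold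
  \<open>N m\<close> has been passed by \<open>n\<close>: it tends to infinity, yet slowly enough
  that the bound for index \<open>M n\<close> is already in force at \<open>n\<close>.\<close>

lemma ex_diagonal_index:
  fixes b :: "nat \<Rightarrow> nat \<Rightarrow> real"
  assumes b: "\<And>m. b m \<longlonglongrightarrow> 0" and nn: "\<And>m n. 0 \<le> b m n"
  obtains M where "filterlim M at_top sequentially" "(\<lambda>n. b (M n) n) \<longlonglongrightarrow> 0"
proof -
  have "\<exists>N. \<forall>n\<ge>N. b m n < 1 / real (Suc m)" for m
    using order_tendstoD(2)[OF b, of "1 / real (Suc m)" m] by (auto simp: eventually_sequentially)
  then obtain N where N: "\<And>m n. n \<ge> N m \<Longrightarrow> b m n < 1 / real (Suc m)" by metis
  define S where "S n = {m. m \<le> n \<and> (m = 0 \<or> N m \<le> n)}" for n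
  define M where "M n = Max (S n)" for n
  have fin: "finite (S n)" for n by (rule finite_subset[of _ "{..n}"]) (auto simp: S_def)
  have MS: "M n \<in> S n" for n
    unfolding M_def using fin by (rule Max_in) (auto simp: S_def)
  have ge: "m \<le> M n" if "n \<ge> max m (N m)" for m n
    unfolding M_def using fin by (rule Max_ge) (use that in \<open>auto simp: S_def\<close>)
  have M: "filterlim M at_top sequentially"
    unfolding filterlim_at_top eventually_sequentially using ge by blast
  have inv: "(\<lambda>n. 1 / real (Suc (M n))) \<longlonglongrightarrow> 0"
    using filterlim_compose[OF LIMSEQ_inverse_real_of_nat M] by (simp add: inverse_eq_divide)
  have up: "\<forall>\<^sub>F n in sequentially. b (M n) n \<le> 1 / real (Suc (M n))"
    using M[unfolded filterlim_at_top, rule_format, of 1]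
  proof eventually_elim
    case (elim n)
    then show ?case using MS[of n] N[of "M n" n] by (auto simp: S_def intro: less_imp_le)
  qed
  have "(\<lambda>n. b (M n) n) \<longlonglongrightarrow> 0"
    by (rule tendsto_sandwich[OF _ up tendsto_const inv]) (simp add: nn)
  with M show thesis by (rule that)
qed

text \<open>For each accuracy \<open>1 / Suc m\<close> there is an estimator whose failure bound
  \<open>b m n\<close> vanishes as \<open>n\<close> grows; the diagonal index lets accuracy and
  failure bound vanish together. Failure is recorded by a measurable set \<open>A\<close> containing
  the bad samples, since \<open>loss\<close> is an arbitrary function.\<close>

lemma ex_uniformly_consistent_estimator:
  fixes p :: "'p \<Rightarrow> real measure" and h :: "nat \<Rightarrow> real \<Rightarrow> real" and loss :: "'p \<Rightarrow> 'p \<Rightarrow> real"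
  assumes U: "U \<noteq> {}" and p: "\<And>\<theta>. \<theta> \<in> U \<Longrightarrow> prob_space (p \<theta>) \<and> sets (p \<theta>) = sets borel"
    and h[measurable]: "\<And>j. h j \<in> borel_measurable borel" and bd: "\<And>j x. \<bar>h j x\<bar> \<le> 1"
    and loss: "\<And>\<delta>. \<delta> > 0 \<Longrightarrow> \<exists>J. \<exists>\<eta>>0. \<forall>\<theta>\<in>U. \<forall>\<theta>'\<in>U.
      (\<forall>j<J. \<bar>(LINT x|p \<theta>'. h j x) - (LINT x|p \<theta>. h j x)\<bar> < \<eta>) \<longrightarrow> loss \<theta>' \<theta> < \<delta>"
  obtains T :: "nat \<Rightarrow> (nat \<Rightarrow> real) \<Rightarrow> 'p" and \<epsilon> \<beta> :: "nat \<Rightarrow> real" where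
    "\<And>n s. T n s \<in> U" "\<And>n. finite (range (T n))"
    "\<And>n. T n \<in> measurable (sample_space n) (count_space UNIV)"
    "\<epsilon> \<longlonglongrightarrow> 0" "\<beta> \<longlonglongrightarrow> 0"
    "\<And>\<theta> n. \<theta> \<in> U \<Longrightarrow> n \<ge> 1 \<Longrightarrow> \<exists>A\<in>sets (\<Pi>\<^sub>M i\<in>{1..n}. p \<theta>). measure (\<Pi>\<^sub>M i\<in>{1..n}. p \<theta>) A \<le> \<beta> n \<and>
       (\<forall>s\<in>space (\<Pi>\<^sub>M i\<in>{1..n}. p \<theta>) - A. loss (T n s) \<theta> < \<epsilon> n)"
proof -
  have "\<forall>m. \<exists>J \<eta>. \<eta> > 0 \<and> (\<forall>\<theta>\<in>U. \<forall>\<theta>'\<in>U.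
      (\<forall>j<J. \<bar>(LINT x|p \<theta>'. h j x) - (LINT x|p \<theta>. h j x)\<bar> < \<eta>) \<longrightarrow> loss \<theta>' \<theta> < 1 / real (Suc m))"
    using loss by (metis of_nat_0_less_iff zero_less_Suc zero_less_divide_1_iff)
  then obtain J \<eta> where \<eta>: "\<And>m. \<eta> m > (0::real)"
    and J: "\<And>m \<theta> \<theta>'. \<theta> \<in> U \<Longrightarrow> \<theta>' \<in> U \<Longrightarrow>
      (\<And>j. j < (J m :: nat) \<Longrightarrow> \<bar>(LINT x|p \<theta>'. h j x) - (LINT x|p \<theta>. h j x)\<bar> < \<eta> m) \<Longrightarrow> loss \<theta>' \<theta> < 1 / real (Suc m)"
    by metis
  define b where "b m n = J m * (2 * exp (- (real n * (\<eta> m / 4)\<^sup>2 / 2)))" for m n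
  \<comment> \<open>Bundled into one predicate so that a single choice over \<open>m\<close>
    delivers the estimators with all their properties.\<close>
  define Q where "Q m T \<longleftrightarrow> (\<forall>n s. T n s \<in> U) \<and> (\<forall>n. finite (range (T n))) \<and>
    (\<forall>n. T n \<in> measurable (sample_space n) (count_space UNIV)) \<and>
    (\<forall>\<theta>\<in>U. \<forall>n\<ge>1. \<exists>A\<in>sets (\<Pi>\<^sub>M i\<in>{1..n}. p \<theta>). measure (\<Pi>\<^sub>M i\<in>{1..n}. p \<theta>) A \<le> b m n \<and>
       (\<forall>s\<in>space (\<Pi>\<^sub>M i\<in>{1..n}. p \<theta>) - A. loss (T n s) \<theta> < 1 / real (Suc m)))" for m and T :: "nat \<Rightarrow> (nat \<Rightarrow> real) \<Rightarrow> 'p"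
  have "\<exists>T. Q m T" for m
  proof -
    obtain T where T: "\<And>n s. T n s \<in> U" "\<And>n. finite (range (T n))"
      "\<And>n. T n \<in> measurable (sample_space n) (count_space UNIV)"
      "\<And>\<theta> n. \<theta> \<in> U \<Longrightarrow> n \<ge> 1 \<Longrightarrow> \<exists>A\<in>sets (\<Pi>\<^sub>M i\<in>{1..n}. p \<theta>). measure (\<Pi>\<^sub>M i\<in>{1..n}. p \<theta>) A \<le> b m n \<and>
       (\<forall>s\<in>space (\<Pi>\<^sub>M i\<in>{1..n}. p \<theta>) - A. \<forall>j<J m. \<bar>(LINT x|p (T n s). h j x) - (LINT x|p \<theta>. h j x)\<bar> < \<eta> m)"
      unfolding b_def by (rule minimum_distance_estimator[where J="J m" and h=h and p=p and U=U, OF U p h bd \<eta>[of m]]) (assumption, blast)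
    have "\<exists>A\<in>sets (\<Pi>\<^sub>M i\<in>{1..n}. p \<theta>). measure (\<Pi>\<^sub>M i\<in>{1..n}. p \<theta>) A \<le> b m n \<and>
       (\<forall>s\<in>space (\<Pi>\<^sub>M i\<in>{1..n}. p \<theta>) - A. loss (T n s) \<theta> < 1 / real (Suc m))"
      if \<theta>: "\<theta> \<in> U" "n \<ge> 1" for \<theta> n
    proof -
      obtain A where A: "A \<in> sets (\<Pi>\<^sub>M i\<in>{1..n}. p \<theta>)" "measure (\<Pi>\<^sub>M i\<in>{1..n}. p \<theta>) A \<le> b m n"
        "\<And>s j. s \<in> space (\<Pi>\<^sub>M i\<in>{1..n}. p \<theta>) - A \<Longrightarrow> j < J m \<Longrightarrow>
          \<bar>(LINT x|p (T n s). h j x) - (LINT x|p \<theta>. h j x)\<bar> < \<eta> m"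
        using T(4)[OF \<theta>] by blast
      have "loss (T n s) \<theta> < 1 / real (Suc m)" if "s \<in> space (\<Pi>\<^sub>M i\<in>{1..n}. p \<theta>) - A" for s
        by (rule J[OF \<theta>(1) T(1) A(3)[OF that]])
      with A(1,2) show ?thesis by (intro bexI[of _ A]) auto
    qed
    with T(1-3) have "Q m T" unfolding Q_def by blast
    then show ?thesis by (rule exI[of _ T])
  qed
  then obtain T where "\<And>m. Q m (T m)" by metis
  note T = this[unfolded Q_def, THEN conjunct1] this[unfolded Q_def, THEN conjunct2, THEN conjunct1]
    this[unfolded Q_def, THEN conjunct2, THEN conjunct2, THEN conjunct1]
    this[unfolded Q_def, THEN conjunct2, THEN conjunct2, THEN conjunct2]
  have "b m \<longlonglongrightarrow> 0" for m
  proof -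
    have "filterlim (\<lambda>n. (\<eta> m / 4)\<^sup>2 / 2 * real n) at_top sequentially"
      using \<eta>[of m] by (intro filterlim_tendsto_pos_mult_at_top[OF tendsto_const _ filterlim_real_sequentially]) auto
    then have "(\<lambda>n. exp (- ((\<eta> m / 4)\<^sup>2 / 2 * real n))) \<longlonglongrightarrow> 0"
      by (intro filterlim_compose[OF exp_at_bot]) (simp add: filterlim_uminus_at_bot)
    from tendsto_mult[OF tendsto_const this, of "J m * 2"] show ?thesis
      by (simp add: b_def[abs_def] mult_ac)
  qed
  then obtain M where M: "filterlim M at_top sequentially" "(\<lambda>n. b (M n) n) \<longlonglongrightarrow> 0"
    using ex_diagonal_index[of b] by (auto simp: b_def)
  show thesis
  proof (rule that[of "\<lambda>n. T (M n) n" "\<lambda>n. 1 / real (Suc (M n))" "\<lambda>n. b (M n) n"])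
    show "(\<lambda>n. 1 / real (Suc (M n))) \<longlonglongrightarrow> 0"
      using filterlim_compose[OF LIMSEQ_inverse_real_of_nat M(1)] by (simp add: inverse_eq_divide)
    show "\<exists>A\<in>sets (\<Pi>\<^sub>M i\<in>{1..n}. p \<theta>). measure (\<Pi>\<^sub>M i\<in>{1..n}. p \<theta>) A \<le> b (M n) n \<and>
       (\<forall>s\<in>space (\<Pi>\<^sub>M i\<in>{1..n}. p \<theta>) - A. loss (T (M n) n s) \<theta> < 1 / real (Suc (M n)))"
      if "\<theta> \<in> U" "n \<ge> 1" for \<theta> n
      using T(4)[of "M n"] that by (elim ballE allE impE) auto
  qed (use T(1-3) M(2) in simp_all)
qed

subsection \<open>Ordering the components by location\<close>

lemma ex_sorting_permutation:
  fixes key :: "nat \<Rightarrow> real"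
  assumes "inj_on key {1..K}"
  obtains \<tau> where "\<tau> permutes {1..K}"
    "\<And>j k. \<lbrakk>j \<in> {1..K}; k \<in> {1..K}; j < k\<rbrakk> \<Longrightarrow> key (\<tau> j) < key (\<tau> k)"
proof -
  define xs where "xs = sorted_list_of_set (key ` {1..K})"
  have len: "length xs = K" and set: "set xs = key ` {1..K}" and sorted: "sorted_wrt (<) xs"
    using assms by (auto simp: xs_def card_image)
  \<comment> \<open>Components are numbered from 1 and list positions from 0, hence
    \<open>i - 1\<close>; \<open>permutes\<close> demands the identity outside
    \<open>{1..K}\<close>.\<close>
  define \<tau> where "\<tau> i = (if i \<in> {1..K} then inv_into {1..K} key (xs ! (i - 1)) else i)" for i
  have nth: "xs ! (i - 1) \<in> key ` {1..K}" if "i \<in> {1..K}" for i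
    using that len set nth_mem[of "i - 1" xs] by auto
  have key: "key (\<tau> i) = xs ! (i - 1)" if "i \<in> {1..K}" for i
    using f_inv_into_f[OF nth[OF that]] that by (simp add: \<tau>_def)
  have mono: "key (\<tau> j) < key (\<tau> k)" if "j \<in> {1..K}" "k \<in> {1..K}" "j < k" for j k
  proof -
    have "xs ! (j - 1) < xs ! (k - 1)"
      by (rule sorted_wrt_nth_less[OF sorted]) (use that len in auto)
    then show ?thesis using that by (simp only: key)
  qed
  have "inj_on \<tau> {1..K}"
  proof (rule linorder_inj_onI')
    fix j k assume "j \<in> {1..K}" "k \<in> {1..K}" "j < k"
    then show "\<tau> j \<noteq> \<tau> k" using mono by fastforce
  qed
  moreover have "\<tau> ` {1..K} \<subseteq> {1..K}"
    using inv_into_into[OF nth] by (auto simp: \<tau>_def)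
  ultimately have "bij_betw \<tau> {1..K} {1..K}"
    by (simp add: bij_betw_def endo_inj_surj)
  then have "\<tau> permutes {1..K}"
    by (rule bij_imp_permutes) (auto simp only: \<tau>_def if_False)
  with mono show thesis using that by blast
qed

lemma gauss_conv_translate:
  assumes "real_distribution G"
  shows "gauss_conv \<sigma> (translate G m) x = gauss_conv \<sigma> G (x - m)"
proof -
  interpret real_distribution G by fact
  show ?thesis
    unfolding gauss_conv_def translate_def
    by (subst integral_distr) (auto simp: normal_density_def algebra_simps)
qed

text \<open>Passes from supports to intervals: each interval is the convex hull of a support, its
  endpoints belong to the support by compactness, and its length is at most the diameter. Sorting is
  by left endpoint after translation.\<close>

lemma ex_admissible_sorting:
  assumes \<sigma>: "\<sigma> > 0" and \<theta>: "\<theta> \<in> mixture_class K \<sigma>"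
    and B: "\<And>k. k \<in> {1..K} \<Longrightarrow> diameter (msupp (mixing \<sigma> (comp \<theta> k))) \<le> B"
      "\<And>k. k \<in> {1..K} \<Longrightarrow> \<bar>shift \<theta> k\<bar> \<le> B"
    and m: "\<And>k. k \<in> {1..K} \<Longrightarrow> m \<le> weight \<theta> k"
    and c: "0 < c" "ereal c \<le> min_dist K \<sigma> \<theta> - ereal (max_diam K \<sigma> \<theta>)"
  defines "G \<equiv> \<lambda>k. mixing \<sigma> (comp \<theta> k)"
  shows "\<And>k. k \<in> {1..K} \<Longrightarrow> real_distribution (G k) \<and> comp \<theta> k = gauss_conv \<sigma> (G k)"
    "\<exists>\<tau> a b. \<tau> permutes {1..K} \<and>
      admissible K B m c (\<lambda>k. weight \<theta> (\<tau> k)) (\<lambda>k. shift \<theta> (\<tau> k)) (\<lambda>k. G (\<tau> k)) a b"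
proof -
  have cl: "\<exists>G. compact_prob G \<and> comp \<theta> k = gauss_conv \<sigma> G"
    "has_bochner_integral lborel (\<lambda>x. x * comp \<theta> k x) 0" if "k \<in> {1..K}" for k
    using \<theta> that by (auto simp: mixture_class_def)
  have sum1: "(\<Sum>k=1..K. weight \<theta> k) = 1"
    using \<theta> by (simp add: mixture_class_def)
  have G: "compact_prob (G k)" "comp \<theta> k = gauss_conv \<sigma> (G k)" if "k \<in> {1..K}" for k
    using someI_ex[OF cl(1)[OF that]] by (auto simp: G_def mixing_def)
  have rd: "real_distribution (G k)" and cpt: "compact (msupp (G k))" if "k \<in> {1..K}" for k
    using G(1)[OF that] by (auto simp: compact_prob_def)
  show "real_distribution (G k) \<and> comp \<theta> k = gauss_conv \<sigma> (G k)" if "k \<in> {1..K}" for k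
    using rd G(2) that by simp
  define a b where "a k = Inf (msupp (G k))" and "b k = Sup (msupp (G k))" for k
  have ab: "AE t in G k. t \<in> {a k..b k}" "a k \<in> msupp (G k)" "b k \<in> msupp (G k)"
    "b k - a k \<le> diameter (msupp (G k))" "a k \<le> b k" "a k \<le> 0" "0 \<le> b k" "(LINT t|G k. t) = 0"
    if k: "k \<in> {1..K}" for k
  proof -
    interpret real_distribution "G k" by (rule rd[OF k])
    have AE: "AE t in G k. t \<in> msupp (G k)" by (rule AE_msupp) simp
    have ne: "msupp (G k) \<noteq> {}"
      using AE by (auto simp: AE_False)
    note c = cpt[OF k]
    have bdd: "bdd_below (msupp (G k))" "bdd_above (msupp (G k))" "closed (msupp (G k))" "bounded (msupp (G k))"
      using c by (auto intro: bounded_imp_bdd_below bounded_imp_bdd_above compact_imp_bounded compact_imp_closed)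
    show mem: "a k \<in> msupp (G k)" "b k \<in> msupp (G k)"
      unfolding a_def b_def using ne bdd by (auto intro: closed_contains_Inf closed_contains_Sup)
    have le: "a k \<le> t \<and> t \<le> b k" if "t \<in> msupp (G k)" for t
      unfolding a_def b_def using that bdd by (auto intro: cInf_lower cSup_upper)
    show "a k \<le> b k" using le mem by blast
    show AE2: "AE t in G k. t \<in> {a k..b k}"
      using AE by (rule eventually_mono) (use le in auto)
    show "b k - a k \<le> diameter (msupp (G k))"
      using diameter_bounded_bound[OF bdd(4) mem(2,1)] by (simp add: dist_real_def)
    have bnd: "AE t in G k. \<bar>t\<bar> \<le> \<bar>a k\<bar> + \<bar>b k\<bar>"
      using AE2 by (rule eventually_mono) auto
    have "has_bochner_integral lborel (\<lambda>x. x * comp \<theta> k x) (LINT t|G k. t)"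
      unfolding G(2)[OF k] by (rule has_bochner_integral_gauss_conv_id[OF \<sigma> rd[OF k] bnd])
    then show mean: "(LINT t|G k. t) = 0"
      using cl(2)[OF k] has_bochner_integral_eq by blast
    have int: "integrable (G k) (\<lambda>t. t)"
      by (rule integrable_const_bound[OF _ ]) (use bnd in auto)
    \<comment> \<open>(D1) bounds the size of a support, not its location. A centred law has 0 in
      the hull of its support, so the diameter bound also confines both endpoints to
      \<open>{-B..B}\<close>.\<close>
    have "AE t in G k. a k \<le> t" "AE t in G k. t \<le> b k" using AE2 by auto
    then show "a k \<le> 0" "0 \<le> b k"
      using integral_ge_const[OF int, of "a k"] integral_le_const[OF int, of "b k"] mean by auto
  qed
  have diam: "diameter (msupp (G k)) \<le> max_diam K \<sigma> \<theta>" if "k \<in> {1..K}" for k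
    unfolding max_diam_def G_def using that by (intro Max_ge) auto
  have dist: "max_diam K \<sigma> \<theta> + c \<le> \<bar>x - y\<bar>"
    if jk: "j \<in> {1..K}" "k \<in> {1..K}" "j \<noteq> k" and x: "x - shift \<theta> j \<in> msupp (G j)" and y: "y - shift \<theta> k \<in> msupp (G k)"
    for j k x y
  proof -
    let ?S = "\<lambda>k. msupp (translate (G k) (shift \<theta> k))"
    have "ereal (c + max_diam K \<sigma> \<theta>) \<le> min_dist K \<sigma> \<theta>"
      using c(2) by (cases "min_dist K \<sigma> \<theta>") auto
    also have "\<dots> \<le> ereal (setdist (?S j) (?S k))"
      unfolding min_dist_def G_def using jk by (intro INF_lower2[of j] INF_lower2[of k]) auto
    also have "setdist (?S j) (?S k) \<le> dist x y"
      using msupp_translate[OF _ x, of "shift \<theta> j"] msupp_translate[OF _ y, of "shift \<theta> k"] rd[OF jk(1)] rd[OF jk(2)]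
      by (intro setdist_le_dist) (auto simp: real_distribution.events_eq_borel)
    finally show ?thesis by (simp add: dist_real_def)
  qed
  define key where "key k = a k + shift \<theta> k" for k
  \<comment> \<open>Disjoint supports could still interleave. Here the left end of \<open>k\<close>
    is further from the left end of \<open>j\<close> than the hull of \<open>j\<close> is long, so
    it lies beyond the right end of that hull, and the distance bound there gives the full
    gap.\<close>
  have sep: "max_diam K \<sigma> \<theta> + c \<le> key k - (b j + shift \<theta> j)"
    if jk: "j \<in> {1..K}" "k \<in> {1..K}" "j \<noteq> k" "key j \<le> key k" for j k
  proof -
    have 1: "max_diam K \<sigma> \<theta> + c \<le> \<bar>key k - key j\<bar>"
      using dist[of k j "key k" "key j"] jk ab(2) by (auto simp: key_def)
    have 2: "max_diam K \<sigma> \<theta> + c \<le> \<bar>key k - (b j + shift \<theta> j)\<bar>"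
      using dist[of k j "key k" "b j + shift \<theta> j"] jk ab(2,3) by (auto simp: key_def)
    have 3: "b j + shift \<theta> j - key j \<le> max_diam K \<sigma> \<theta>"
      using ab(4)[OF jk(1)] diam[OF jk(1)] by (simp add: key_def)
    show ?thesis using 1 2 3 jk(4) c(1) by linarith
  qed
  have "inj_on key {1..K}"
  proof (rule inj_onI, rule ccontr)
    fix j k assume jk: "j \<in> {1..K}" "k \<in> {1..K}" "key j = key k" "j \<noteq> k"
    have "0 \<le> max_diam K \<sigma> \<theta>" using diam[OF jk(1)] ab(4,5)[OF jk(1)] by linarith
    moreover have "key j \<le> b j + shift \<theta> j" using ab(5)[OF jk(1)] by (simp add: key_def)
    ultimately show False using sep[OF jk(1,2,4)] jk(3) c(1) by linarith
  qed
  then obtain \<tau> where \<tau>: "\<tau> permutes {1..K}"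
    "\<And>j k. \<lbrakk>j \<in> {1..K}; k \<in> {1..K}; j < k\<rbrakk> \<Longrightarrow> key (\<tau> j) < key (\<tau> k)"
    by (rule ex_sorting_permutation) blast
  have \<tau>K: "\<tau> k \<in> {1..K}" if "k \<in> {1..K}" for k
    using permutes_in_image[OF \<tau>(1)] that by blast
  have "admissible K B m c (\<lambda>k. weight \<theta> (\<tau> k)) (\<lambda>k. shift \<theta> (\<tau> k)) (\<lambda>k. G (\<tau> k)) (\<lambda>k. a (\<tau> k)) (\<lambda>k. b (\<tau> k))"
    unfolding admissible_def
  proof (intro conjI ballI impI)
    fix k assume "k \<in> {1..K}"
    note k = \<tau>K[OF this]
    show "m \<le> weight \<theta> (\<tau> k)" "\<bar>shift \<theta> (\<tau> k)\<bar> \<le> B" "real_distribution (G (\<tau> k))"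
      "a (\<tau> k) \<le> b (\<tau> k)" "AE t in G (\<tau> k). t \<in> {a (\<tau> k)..b (\<tau> k)}" "(LINT t|G (\<tau> k). t) = 0"
      using k m B(2) rd ab(1,5,8) by auto
    show "-B \<le> a (\<tau> k)" "b (\<tau> k) \<le> B"
      using ab(4,6,7)[OF k] B(1)[OF k] by (auto simp: G_def)
  next
    show "(\<Sum>k=1..K. weight \<theta> (\<tau> k)) = 1"
      using sum.permute[OF \<tau>(1), of "weight \<theta>"] sum1 by (simp add: o_def)
  next
    fix j k l assume jkl: "j \<in> {1..K}" "k \<in> {1..K}" "l \<in> {1..K}" "j < k"
    have "\<tau> j \<noteq> \<tau> k" using jkl \<tau>(2) by fastforce
    then have "max_diam K \<sigma> \<theta> + c \<le> key (\<tau> k) - (b (\<tau> j) + shift \<theta> (\<tau> j))"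
      using jkl \<tau>K \<tau>(2) by (intro sep) (auto simp: less_imp_le)
    then show "b (\<tau> l) - a (\<tau> l) + c \<le> a (\<tau> k) + shift \<theta> (\<tau> k) - (b (\<tau> j) + shift \<theta> (\<tau> j))"
      using ab(4)[OF \<tau>K[OF jkl(3)]] diam[OF \<tau>K[OF jkl(3)]] by (simp add: key_def)
  qed
  with \<tau>(1) show "\<exists>\<tau> a b. \<tau> permutes {1..K} \<and>
      admissible K B m c (\<lambda>k. weight \<theta> (\<tau> k)) (\<lambda>k. shift \<theta> (\<tau> k)) (\<lambda>k. G (\<tau> k)) a b"
    by blast
qed

text \<open>Absorbing each shift into the mixing measure, via \<open>gauss_conv_translate\<close>,
  reduces mass and characteristic function to those of unshifted Gaussian convolutions.\<close>

lemma mix_density_law: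
  assumes \<sigma>: "\<sigma> > 0" and G: "\<And>k. k \<in> {1..K} \<Longrightarrow> real_distribution (G k) \<and> comp \<theta> k = gauss_conv \<sigma> (G k)"
    and w: "\<And>k. k \<in> {1..K} \<Longrightarrow> 0 \<le> weight \<theta> k" "(\<Sum>k=1..K. weight \<theta> k) = 1"
  defines "P \<equiv> density lborel (\<lambda>x. ennreal (mix_density K \<theta> x))"
  shows "prob_space P" "sets P = sets borel"
    "(LINT x|P. iexp (u * x)) = exp (- (\<sigma> * u)\<^sup>2 / 2) *\<^sub>R mixture_char K (weight \<theta>) (shift \<theta>) G u"
proof -
  let ?T = "\<lambda>k. translate (G k) (shift \<theta> k)"
  have T: "real_distribution (?T k)" if "k \<in> {1..K}" for k
    using G[OF that] by (intro real_distribution_translate) simp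
  have md: "mix_density K \<theta> x = (\<Sum>k=1..K. weight \<theta> k * gauss_conv \<sigma> (?T k) x)" for x
    unfolding mix_density_def using G by (intro sum.cong refl) (simp add: gauss_conv_translate)
  have nn: "0 \<le> mix_density K \<theta> x" for x
    unfolding md by (intro sum_nonneg mult_nonneg_nonneg w gauss_conv_nonneg)
  have "has_bochner_integral lborel (\<lambda>x. \<Sum>k=1..K. weight \<theta> k * gauss_conv \<sigma> (?T k) x) (\<Sum>k=1..K. weight \<theta> k * 1)"
    by (intro has_bochner_integral_sum has_bochner_integral_mult_right has_bochner_integral_gauss_conv \<sigma> T)
  then have I: "has_bochner_integral lborel (mix_density K \<theta>) 1"
    using w by (simp add: md[abs_def])
  then have meas: "mix_density K \<theta> \<in> borel_measurable borel"
    by (auto simp: has_bochner_integral_iff)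
  show "sets P = sets borel" by (simp add: P_def)
  have "emeasure P (space P) = (\<integral>\<^sup>+x. mix_density K \<theta> x \<partial>lborel)"
    unfolding P_def using meas by (subst emeasure_density) auto
  also have "\<dots> = 1"
    using I nn by (subst nn_integral_eq_integral) (auto simp: has_bochner_integral_iff)
  finally show "prob_space P" by (rule prob_spaceI)
  have "(LINT x|P. iexp (u * x)) = (LINT x|lborel. mix_density K \<theta> x *\<^sub>R iexp (u * x))"
    unfolding P_def using meas nn by (subst integral_density) auto
  also have "\<dots> = (LINT x|lborel. (\<Sum>k=1..K. weight \<theta> k *\<^sub>R (gauss_conv \<sigma> (?T k) x *\<^sub>R iexp (u * x))))"
    by (simp add: md scaleR_sum_left)
  also have "\<dots> = (\<Sum>k=1..K. weight \<theta> k *\<^sub>R (exp (- (\<sigma> * u)\<^sup>2 / 2) *\<^sub>R char (?T k) u))"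
    by (intro has_bochner_integral_integral_eq has_bochner_integral_sum has_bochner_integral_scaleR_right
      has_bochner_integral_gauss_conv_iexp \<sigma> T)
  also have "\<dots> = (\<Sum>k=1..K. exp (- (\<sigma> * u)\<^sup>2 / 2) *\<^sub>R weight \<theta> k *\<^sub>R (iexp (u * shift \<theta> k) * char (G k) u))"
    using G by (intro sum.cong refl) (simp add: char_translate mult.commute)
  also have "\<dots> = exp (- (\<sigma> * u)\<^sup>2 / 2) *\<^sub>R mixture_char K (weight \<theta>) (shift \<theta>) G u"
    unfolding mixture_char_def by (simp only: scaleR_sum_right)
  finally show "(LINT x|P. iexp (u * x)) = exp (- (\<sigma> * u)\<^sup>2 / 2) *\<^sub>R mixture_char K (weight \<theta>) (shift \<theta>) G u" .
qed

text \<open>The sample law does not see the labelling, so it may be described by the sorted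
  parameters.\<close>

lemma mixture_char_permute:
  assumes "\<tau> permutes {1..K}"
  shows "mixture_char K (\<lambda>k. w (\<tau> k)) (\<lambda>k. \<mu> (\<tau> k)) (\<lambda>k. G (\<tau> k)) = mixture_char K w \<mu> G"
  unfolding mixture_char_def
  using sum.permute[OF assms, of "\<lambda>k. w k *\<^sub>R (iexp (_ * \<mu> k) * char (G k) _)"] by (simp add: o_def)

subsection \<open>Consistency\<close>

text \<open>Finitely many values cut the sample space into measurable pieces, on each of which a
  fixed function of \<open>x\<close> is used; this yields joint measurability.\<close>

lemma measurable_comp_finite_range:
  assumes T: "T \<in> measurable M (count_space UNIV)" "finite (range T)"
    and f: "\<And>t. t \<in> range T \<Longrightarrow> f t \<in> borel_measurable borel"
  shows "(\<lambda>(s, x). f (T s) x) \<in> borel_measurable (M \<Otimes>\<^sub>M borel)"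
proof -
  have "T \<in> measurable M (count_space (range T))"
    using T(1) by (auto simp: measurable_def)
  then have g: "(\<lambda>z. T (fst z)) \<in> measurable (M \<Otimes>\<^sub>M borel) (count_space (range T))"
    by (rule measurable_compose[OF measurable_fst])
  have "(\<lambda>z. f (T (fst z)) (snd z)) \<in> borel_measurable (M \<Otimes>\<^sub>M borel)"
  proof (rule measurable_compose_countable'[OF _ g])
    show "(\<lambda>z. f t (snd z)) \<in> borel_measurable (M \<Otimes>\<^sub>M borel)" if "t \<in> range T" for t
      by (rule measurable_compose[OF measurable_snd f[OF that]])
  qed (use T(2) in \<open>simp add: countable_finite\<close>)
  then show ?thesis by (simp add: split_beta)
qed

text \<open>If no choice worked, then \<open>J = n\<close> and \<open>\<eta> = 1 / Suc n\<close>
  would fail for every \<open>n\<close>, giving pairs \<open>x n\<close>, \<open>y n\<close> with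
  loss at least \<open>\<delta>\<close>. Each rational has a finite position in the enumeration
  \<open>q\<close>, so the pairs agree asymptotically at every rational frequency.\<close>

lemma uniform_identifiability:
  fixes w \<mu> a b :: "'p \<Rightarrow> nat \<Rightarrow> real" and G :: "'p \<Rightarrow> nat \<Rightarrow> real measure"
    and \<phi> :: "'p \<Rightarrow> real \<Rightarrow> complex" and f :: "'p \<Rightarrow> nat \<Rightarrow> real \<Rightarrow> real" and q :: "nat \<Rightarrow> real"
  assumes adm: "\<And>\<theta>. \<theta> \<in> U \<Longrightarrow> admissible K B m c (w \<theta>) (\<mu> \<theta>) (G \<theta>) (a \<theta>) (b \<theta>)"
    and pos: "0 < m" "0 < c" "0 < \<sigma>" and K: "K \<ge> 1" and \<delta>: "\<delta> > 0"
    and q: "range q = \<rat>"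
    and \<phi>: "\<And>\<theta> u. \<theta> \<in> U \<Longrightarrow> \<phi> \<theta> u = exp (- (\<sigma> * u)\<^sup>2 / 2) *\<^sub>R mixture_char K (w \<theta>) (\<mu> \<theta>) (G \<theta>) u"
    and f: "\<And>\<theta> k. \<theta> \<in> U \<Longrightarrow> k \<in> {1..K} \<Longrightarrow> f \<theta> k = gauss_conv \<sigma> (G \<theta> k)"
  shows "\<exists>J. \<exists>\<eta>>0. \<forall>\<theta>\<in>U. \<forall>\<theta>'\<in>U.
    (\<forall>j<J. norm (\<phi> \<theta>' (q j) - \<phi> \<theta> (q j)) < \<eta>) \<longrightarrow>
    (MAX k\<in>{1..K}. max \<bar>w \<theta>' k - w \<theta> k\<bar> (L1_norm (\<lambda>x. f \<theta>' k x - f \<theta> k x))) < \<delta>"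
proof (rule ccontr)
  let ?C = "\<lambda>\<theta> t. mixture_char K (w \<theta>) (\<mu> \<theta>) (G \<theta>) t"
  let ?D = "\<lambda>\<theta>' \<theta> j. norm (\<phi> \<theta>' (q j) - \<phi> \<theta> (q j))"
  let ?l = "\<lambda>\<theta>' \<theta> k. max \<bar>w \<theta>' k - w \<theta> k\<bar> (L1_norm (\<lambda>x. f \<theta>' k x - f \<theta> k x))"
  assume neg: "\<not> (\<exists>J. \<exists>\<eta>>0. \<forall>\<theta>\<in>U. \<forall>\<theta>'\<in>U. (\<forall>j<J. ?D \<theta>' \<theta> j < \<eta>) \<longrightarrow> (MAX k\<in>{1..K}. ?l \<theta>' \<theta> k) < \<delta>)"
  define Q where "Q n \<theta> \<theta>' \<longleftrightarrow> \<theta> \<in> U \<and> \<theta>' \<in> U \<and> (\<forall>j<n. ?D \<theta>' \<theta> j < 1 / real (Suc n)) \<and> \<not> (MAX k\<in>{1..K}. ?l \<theta>' \<theta> k) < \<delta>"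
    for n :: nat and \<theta> \<theta>'
  have "\<exists>\<theta> \<theta>'. Q n \<theta> \<theta>'" for n
  proof (rule ccontr)
    assume "\<not> ?thesis"
    then have "\<forall>\<theta>\<in>U. \<forall>\<theta>'\<in>U. (\<forall>j<n. ?D \<theta>' \<theta> j < 1 / real (Suc n)) \<longrightarrow> (MAX k\<in>{1..K}. ?l \<theta>' \<theta> k) < \<delta>"
      unfolding Q_def by blast
    moreover have "0 < 1 / real (Suc n)" by simp
    ultimately show False using neg by blast
  qed
  then obtain x y where "\<And>n. Q n (x n) (y n)" by metis
  then have xy: "\<And>n. x n \<in> U" "\<And>n. y n \<in> U"
      "\<And>n j. j < n \<Longrightarrow> ?D (y n) (x n) j < 1 / real (Suc n)" "\<And>n. \<not> (MAX k\<in>{1..K}. ?l (y n) (x n) k) < \<delta>"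
    unfolding Q_def by blast+
  have "(\<lambda>n. ?C (y n) t - ?C (x n) t) \<longlonglongrightarrow> 0" if t: "t \<in> \<rat>" for t
  proof -
    obtain j where j: "t = q j" using t q by (metis rangeE)
    \<comment> \<open>The Gaussian factor is not bounded away from 0 across frequencies, but here
      the frequency is fixed while \<open>n\<close> grows, so dividing by it is harmless.\<close>
    define e where "e = exp (- (\<sigma> * q j)\<^sup>2 / 2)"
    have e: "e > 0" by (simp add: e_def)
    have "(\<lambda>n. e *\<^sub>R (?C (y n) t - ?C (x n) t)) \<longlonglongrightarrow> 0"
    proof (rule Lim_null_comparison)
      show "\<forall>\<^sub>F n in sequentially. norm (e *\<^sub>R (?C (y n) t - ?C (x n) t)) \<le> 1 / real (Suc n)"
        using eventually_gt_at_top[of j]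
      proof eventually_elim
        case (elim n)
        then show ?case using xy(3)[of j n] by (simp only: j e_def scaleR_diff_right less_imp_le \<phi>[OF xy(1)] \<phi>[OF xy(2)])
      qed
      show "(\<lambda>n. 1 / real (Suc n)) \<longlonglongrightarrow> 0"
        using LIMSEQ_inverse_real_of_nat by (simp add: inverse_eq_divide)
    qed
    from tendsto_scaleR[OF tendsto_const this, of "1 / e"] e show ?thesis by simp
  qed
  from tendsto_components_if_chars_close[of K B m c "\<lambda>n. w (y n)" "\<lambda>n. \<mu> (y n)" "\<lambda>n. G (y n)" "\<lambda>n. a (y n)" "\<lambda>n. b (y n)"
      "\<lambda>n. w (x n)" "\<lambda>n. \<mu> (x n)" "\<lambda>n. G (x n)" "\<lambda>n. a (x n)" "\<lambda>n. b (x n)", OF adm[OF xy(2)] adm[OF xy(1)] pos this]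
  obtain r where r: "\<And>k. k \<in> {1..K} \<Longrightarrow> (\<lambda>n. w (y (r n)) k - w (x (r n)) k) \<longlonglongrightarrow> 0"
      "\<And>k. k \<in> {1..K} \<Longrightarrow> (\<lambda>n. L1_norm (\<lambda>z. f (y (r n)) k z - f (x (r n)) k z)) \<longlonglongrightarrow> 0"
    using f[OF xy(1)] f[OF xy(2)] by force
  have "\<forall>\<^sub>F n in sequentially. \<forall>k\<in>{1..K}. ?l (y (r n)) (x (r n)) k < \<delta>"
  proof (intro eventually_ball_finite ballI)
    fix k assume k: "k \<in> {1..K}"
    have "(\<lambda>n. ?l (y (r n)) (x (r n)) k) \<longlonglongrightarrow> max \<bar>0\<bar> 0"
      by (intro tendsto_intros r k)
    then show "\<forall>\<^sub>F n in sequentially. ?l (y (r n)) (x (r n)) k < \<delta>"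
      using \<delta> by (intro order_tendstoD(2)) auto
  qed simp
  then obtain n where "\<forall>k\<in>{1..K}. ?l (y (r n)) (x (r n)) k < \<delta>"
    by (auto simp only: eventually_sequentially)
  then have "(MAX k\<in>{1..K}. ?l (y (r n)) (x (r n)) k) < \<delta>"
    using K by (subst Max_less_iff) auto
  with xy(4)[of "r n"] show False by simp
qed

theorem theorem5p1:
  fixes K :: nat and \<sigma> :: real and \<U> :: "mixture_tuple set"
  assumes "K \<ge> 1" and "\<sigma> > 0"
    and "\<U> \<subseteq> mixture_class K \<sigma>"
    and D1: "(SUP \<theta>\<in>\<U>. ereal (MAX k\<in>{1..K}.
               max (diameter (msupp (mixing \<sigma> (comp \<theta> k)))) \<bar>shift \<theta> k\<bar>)) < \<infinity>"
    and D2: "(INF \<theta>\<in>\<U>. ereal (MIN k\<in>{1..K}. weight \<theta> k)) > 0"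
    and D3: "(INF \<theta>\<in>\<U>. min_dist K \<sigma> \<theta> - ereal (max_diam K \<sigma> \<theta>)) > 0"
  shows "\<exists>(lhat :: nat \<Rightarrow> nat \<Rightarrow> (nat \<Rightarrow> real) \<Rightarrow> real)
          (fhat :: nat \<Rightarrow> nat \<Rightarrow> (nat \<Rightarrow> real) \<Rightarrow> real \<Rightarrow> real)
          (perm :: mixture_tuple \<Rightarrow> nat \<Rightarrow> nat \<Rightarrow> nat) (\<epsilon> :: nat \<Rightarrow> real).
      (\<forall>n. \<forall>k\<in>{1..K}. real_estimator n (lhat n k) \<and> L1_estimator n (fhat n k)) \<and>
      (\<forall>\<theta>\<in>\<U>. \<forall>n. perm \<theta> n permutes {1..K}) \<and>
      \<epsilon> \<longlonglongrightarrow> 0 \<and>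
      (\<lambda>n. SUP \<theta>\<in>\<U>. emeasure (sample_law K \<theta> n)
         {s \<in> space (sample_law K \<theta> n).
            (MAX k\<in>{1..K}. max \<bar>lhat n k s - weight \<theta> (perm \<theta> n k)\<bar>
               (L1_norm (\<lambda>x. fhat n k s x - comp \<theta> (perm \<theta> n k) x))) > \<epsilon> n})
        \<longlonglongrightarrow> 0"
proof (cases "\<U> = {}")
  \<comment> \<open>Without parameters there is no net to choose from; the supremum is 0 and trivial
    estimators serve.\<close>
  case True
  show ?thesis
    by (rule exI[of _ "\<lambda>_ _ _. 0"], rule exI[of _ "\<lambda>_ _ _ _. 0"], rule exI[of _ undefined], rule exI[of _ "\<lambda>_. 0"])
      (simp add: True real_estimator_def L1_estimator_def split_beta bot_ennreal)
next
  case False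
  note \<sigma> = assms(2)
  define S where "S = (SUP \<theta>\<in>\<U>. ereal (MAX k\<in>{1..K}. max (diameter (msupp (mixing \<sigma> (comp \<theta> k)))) \<bar>shift \<theta> k\<bar>))"
  obtain B where B0: "S \<le> ereal B"
    using D1 unfolding S_def[symmetric] by (cases S) auto
  have B: "diameter (msupp (mixing \<sigma> (comp \<theta> k))) \<le> B" "\<bar>shift \<theta> k\<bar> \<le> B" if "\<theta> \<in> \<U>" "k \<in> {1..K}" for \<theta> k
  proof -
    have "ereal (MAX k\<in>{1..K}. max (diameter (msupp (mixing \<sigma> (comp \<theta> k)))) \<bar>shift \<theta> k\<bar>) \<le> ereal B"
      using SUP_upper[OF that(1)] B0 unfolding S_def by (rule order_trans)
    then have "(MAX k\<in>{1..K}. max (diameter (msupp (mixing \<sigma> (comp \<theta> k)))) \<bar>shift \<theta> k\<bar>) \<le> B" by simp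
    moreover have "max (diameter (msupp (mixing \<sigma> (comp \<theta> k)))) \<bar>shift \<theta> k\<bar> \<le>
       (MAX k\<in>{1..K}. max (diameter (msupp (mixing \<sigma> (comp \<theta> k)))) \<bar>shift \<theta> k\<bar>)"
      using that(2) by (intro Max_ge) auto
    ultimately show "diameter (msupp (mixing \<sigma> (comp \<theta> k))) \<le> B" "\<bar>shift \<theta> k\<bar> \<le> B" by auto
  qed
  obtain m where m0: "0 < ereal m" "ereal m < (INF \<theta>\<in>\<U>. ereal (MIN k\<in>{1..K}. weight \<theta> k))"
    using ereal_dense2[OF D2] by auto
  have m: "m \<le> weight \<theta> k" if "\<theta> \<in> \<U>" "k \<in> {1..K}" for \<theta> k
  proof -
    have "ereal m \<le> ereal (MIN k\<in>{1..K}. weight \<theta> k)"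
      using less_imp_le[OF m0(2)] INF_lower[OF that(1)] by (rule order_trans)
    then have "m \<le> (MIN k\<in>{1..K}. weight \<theta> k)" by simp
    also have "\<dots> \<le> weight \<theta> k" using that(2) by (intro Min_le) auto
    finally show ?thesis .
  qed
  \<comment> \<open>The infimum in (D3) is infinite when \<open>K = 1\<close>, so a finite positive
    \<open>c\<close> below it is chosen by density.\<close>
  obtain c where c0: "0 < ereal c" "ereal c < (INF \<theta>\<in>\<U>. min_dist K \<sigma> \<theta> - ereal (max_diam K \<sigma> \<theta>))"
    using ereal_dense2[OF D3] by auto
  have c: "ereal c \<le> min_dist K \<sigma> \<theta> - ereal (max_diam K \<sigma> \<theta>)" if "\<theta> \<in> \<U>" for \<theta>
    using less_imp_le[OF c0(2)] INF_lower[OF that] by (rule order_trans)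
  have pos: "0 < m" "0 < c" using m0 c0 by auto
  define G where "G \<theta> k = mixing \<sigma> (comp \<theta> k)" for \<theta> :: mixture_tuple and k
  have cls: "\<theta> \<in> mixture_class K \<sigma>" if "\<theta> \<in> \<U>" for \<theta> using assms(3) that by blast
  note sorting = ex_admissible_sorting[OF \<sigma> cls B m pos(2) c, folded G_def]
  have G: "real_distribution (G \<theta> k)" "comp \<theta> k = gauss_conv \<sigma> (G \<theta> k)" if "\<theta> \<in> \<U>" "k \<in> {1..K}" for \<theta> k
    using sorting(1)[of \<theta> k] that by auto
  have "\<forall>\<theta>\<in>\<U>. \<exists>\<tau> a b. \<tau> permutes {1..K} \<and>
      admissible K B m c (\<lambda>k. weight \<theta> (\<tau> k)) (\<lambda>k. shift \<theta> (\<tau> k)) (\<lambda>k. G \<theta> (\<tau> k)) a b"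
    using sorting(2) by blast
  then obtain \<tau> a b where \<tau>: "\<And>\<theta>. \<theta> \<in> \<U> \<Longrightarrow> \<tau> \<theta> permutes {1..K}"
    and adm: "\<And>\<theta>. \<theta> \<in> \<U> \<Longrightarrow>
      admissible K B m c (\<lambda>k. weight \<theta> (\<tau> \<theta> k)) (\<lambda>k. shift \<theta> (\<tau> \<theta> k)) (\<lambda>k. G \<theta> (\<tau> \<theta> k)) (a \<theta>) (b \<theta>)"
    by metis
  have \<tau>K: "\<tau> \<theta> k \<in> {1..K}" if "\<theta> \<in> \<U>" "k \<in> {1..K}" for \<theta> k
    using permutes_in_image[OF \<tau>[OF that(1)]] that(2) by blast
  define p where "p \<theta> = density lborel (\<lambda>x. ennreal (mix_density K \<theta> x))" for \<theta>
  define q :: "nat \<Rightarrow> real" where "q = from_nat_into \<rat>"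
  have q: "range q = \<rat>"
    unfolding q_def using Rats_0 by (intro range_from_nat_into countable_rat) auto
  \<comment> \<open>Frequency \<open>q i\<close> contributes its cosine at index
    \<open>2 * i\<close> and its sine at \<open>2 * i + 1\<close>, which gives real moments bounded
    by 1 as Hoeffding requires.\<close>
  define h where "h j x = (if even j then cos (q (j div 2) * x) else sin (q (j div 2) * x))" for j x
  have sum1: "(\<Sum>k=1..K. weight \<theta> k) = 1" if "\<theta> \<in> \<U>" for \<theta>
    using cls[OF that] by (simp add: mixture_class_def)
  have w0: "0 \<le> weight \<theta> k" if "\<theta> \<in> \<U>" "k \<in> {1..K}" for \<theta> k
    using m[OF that] pos by simp
  have law: "prob_space (p \<theta>)" "sets (p \<theta>) = sets borel"
    "(LINT x|p \<theta>. iexp (u * x)) = exp (- (\<sigma> * u)\<^sup>2 / 2) *\<^sub>R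
       mixture_char K (\<lambda>k. weight \<theta> (\<tau> \<theta> k)) (\<lambda>k. shift \<theta> (\<tau> \<theta> k)) (\<lambda>k. G \<theta> (\<tau> \<theta> k)) u"
    if "\<theta> \<in> \<U>" for \<theta> u
  proof -
    have "real_distribution (G \<theta> k) \<and> comp \<theta> k = gauss_conv \<sigma> (G \<theta> k)" if "k \<in> {1..K}" for k
      using G[OF \<open>\<theta> \<in> \<U>\<close> that] by simp
    note * = mix_density_law[OF \<sigma> this w0[OF that] sum1[OF that], folded p_def]
    show "prob_space (p \<theta>)" "sets (p \<theta>) = sets borel"
      "(LINT x|p \<theta>. iexp (u * x)) = exp (- (\<sigma> * u)\<^sup>2 / 2) *\<^sub>R
       mixture_char K (\<lambda>k. weight \<theta> (\<tau> \<theta> k)) (\<lambda>k. shift \<theta> (\<tau> \<theta> k)) (\<lambda>k. G \<theta> (\<tau> \<theta> k)) u"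
      unfolding mixture_char_permute[OF \<tau>[OF that], of "weight \<theta>" "shift \<theta>" "G \<theta>"] by (rule *; assumption)+
  qed
  \<comment> \<open>Both arguments are compared in their sorted order, so this is the error of the
    theorem with \<open>\<tau> \<theta>\<close> as permutation.\<close>
  define loss where "loss \<theta>' \<theta> = (MAX k\<in>{1..K}. max \<bar>weight \<theta>' (\<tau> \<theta>' k) - weight \<theta> (\<tau> \<theta> k)\<bar>
      (L1_norm (\<lambda>x. comp \<theta>' (\<tau> \<theta>' k) x - comp \<theta> (\<tau> \<theta> k) x)))" for \<theta>' \<theta> :: mixture_tuple
  have loss: "\<exists>J. \<exists>\<eta>>0. \<forall>\<theta>\<in>\<U>. \<forall>\<theta>'\<in>\<U>.
      (\<forall>j<J. \<bar>(LINT x|p \<theta>'. h j x) - (LINT x|p \<theta>. h j x)\<bar> < \<eta>) \<longrightarrow> loss \<theta>' \<theta> < \<delta>" if \<delta>: "\<delta> > 0" for \<delta>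
  proof -
    have "\<exists>J. \<exists>\<eta>>0. \<forall>\<theta>\<in>\<U>. \<forall>\<theta>'\<in>\<U>.
      (\<forall>j<J. norm ((LINT x|p \<theta>'. iexp (q j * x)) - (LINT x|p \<theta>. iexp (q j * x))) < \<eta>) \<longrightarrow> loss \<theta>' \<theta> < \<delta>"
      unfolding loss_def
      by (rule uniform_identifiability[where f="\<lambda>\<theta> k. comp \<theta> (\<tau> \<theta> k)",
          OF adm pos \<sigma> assms(1) \<delta> q law(3) G(2)[OF _ \<tau>K]])
    then obtain J \<eta> where \<eta>: "\<eta> > 0" and J: "\<And>\<theta> \<theta>'. \<theta> \<in> \<U> \<Longrightarrow> \<theta>' \<in> \<U> \<Longrightarrow>
      (\<And>j. j < J \<Longrightarrow> norm ((LINT x|p \<theta>'. iexp (q j * x)) - (LINT x|p \<theta>. iexp (q j * x))) < \<eta>) \<Longrightarrow> loss \<theta>' \<theta> < \<delta>"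
      by blast
    \<comment> \<open>The first \<open>J\<close> frequencies occupy the first \<open>2 * J\<close>
      moments; real and imaginary parts within \<open>\<eta> / 2\<close> put the complex values
      within \<open>\<eta>\<close>.\<close>
    have "loss \<theta>' \<theta> < \<delta>" if \<theta>: "\<theta> \<in> \<U>" "\<theta>' \<in> \<U>"
      and cl: "\<And>j. j < 2 * J \<Longrightarrow> \<bar>(LINT x|p \<theta>'. h j x) - (LINT x|p \<theta>. h j x)\<bar> < \<eta> / 2" for \<theta> \<theta>'
    proof -
      have ReIm: "Re (LINT x|p \<theta>. iexp (q j * x)) = (LINT x|p \<theta>. h (2 * j) x)"
        "Im (LINT x|p \<theta>. iexp (q j * x)) = (LINT x|p \<theta>. h (2 * j + 1) x)" if "\<theta> \<in> \<U>" for \<theta> j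
      proof -
        interpret prob_space "p \<theta>" by (rule law(1)[OF that])
        note [measurable_cong] = law(2)[OF that]
        have "integrable (p \<theta>) (\<lambda>x. iexp (q j * x))"
          by (intro integrable_const_bound[where B=1]) auto
        then show "Re (LINT x|p \<theta>. iexp (q j * x)) = (LINT x|p \<theta>. h (2 * j) x)"
          "Im (LINT x|p \<theta>. iexp (q j * x)) = (LINT x|p \<theta>. h (2 * j + 1) x)"
          by (simp_all add: h_def Re_exp Im_exp flip: integral_Re integral_Im)
      qed
      show ?thesis
      proof (rule J[OF \<theta>])
        fix j assume "j < J"
        then have "\<bar>(LINT x|p \<theta>'. h (2 * j) x) - (LINT x|p \<theta>. h (2 * j) x)\<bar> < \<eta> / 2"
          "\<bar>(LINT x|p \<theta>'. h (2 * j + 1) x) - (LINT x|p \<theta>. h (2 * j + 1) x)\<bar> < \<eta> / 2"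
          using cl[of "2 * j"] cl[of "2 * j + 1"] by simp_all
        then show "norm ((LINT x|p \<theta>'. iexp (q j * x)) - (LINT x|p \<theta>. iexp (q j * x))) < \<eta>"
          using cmod_le[of "(LINT x|p \<theta>'. iexp (q j * x)) - (LINT x|p \<theta>. iexp (q j * x))"]
          by (simp only: minus_complex.sel ReIm \<theta>)
      qed
    qed
    then show ?thesis using \<eta> by (intro exI[of _ "2 * J"] exI[of _ "\<eta> / 2"]) auto
  qed
  have h: "h j \<in> borel_measurable borel" "\<bar>h j x\<bar> \<le> 1" for j x
    unfolding h_def by auto
  have law12: "prob_space (p \<theta>) \<and> sets (p \<theta>) = sets borel" if "\<theta> \<in> \<U>" for \<theta>
    using law(1,2)[OF that] by simp
  obtain T \<epsilon> \<beta> where T: "\<And>n s. T n s \<in> \<U>" "\<And>n. finite (range (T n))"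
    "\<And>n. T n \<in> measurable (sample_space n) (count_space UNIV)" and \<epsilon>: "\<epsilon> \<longlonglongrightarrow> 0" and \<beta>: "\<beta> \<longlonglongrightarrow> 0"
    and TA: "\<And>\<theta> n. \<theta> \<in> \<U> \<Longrightarrow> n \<ge> 1 \<Longrightarrow> \<exists>A\<in>sets (\<Pi>\<^sub>M i\<in>{1..n}. p \<theta>). measure (\<Pi>\<^sub>M i\<in>{1..n}. p \<theta>) A \<le> \<beta> n \<and>
       (\<forall>s\<in>space (\<Pi>\<^sub>M i\<in>{1..n}. p \<theta>) - A. loss (T n s) \<theta> < \<epsilon> n)"
    by (rule ex_uniformly_consistent_estimator[where U=\<U> and p=p and h=h and loss=loss, OF False law12 h loss])
      (assumption+, blast)
  \<comment> \<open>The function \<open>\<tau>\<close> was fixed for the whole family, so evaluating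
    it at the selected parameter \<open>T n s\<close> uses nothing but the sample.\<close>
  define lhat where "lhat n k s = weight (T n s) (\<tau> (T n s) k)" for n k s
  define fhat where "fhat n k s = comp (T n s) (\<tau> (T n s) k)" for n k s
  have f: "integrable lborel (comp \<theta> (\<tau> \<theta> k))" "comp \<theta> (\<tau> \<theta> k) \<in> borel_measurable borel"
    if "\<theta> \<in> \<U>" "k \<in> {1..K}" for \<theta> k
    using has_bochner_integral_gauss_conv[OF \<sigma> G(1)[OF that(1) \<tau>K[OF that]]] G(2)[OF that(1) \<tau>K[OF that]]
    by (auto simp: has_bochner_integral_iff)
  have est: "real_estimator n (lhat n k)" "L1_estimator n (fhat n k)" if k: "k \<in> {1..K}" for n k
  proof -
    show "real_estimator n (lhat n k)"
      unfolding real_estimator_def lhat_def by (rule measurable_compose[OF T(3)]) simp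
    have "(\<lambda>(s, x). comp (T n s) (\<tau> (T n s) k) x) \<in> borel_measurable (sample_space n \<Otimes>\<^sub>M borel)"
      by (rule measurable_comp_finite_range[where f="\<lambda>\<theta>. comp \<theta> (\<tau> \<theta> k)", OF T(3,2)]) (use f(2) T(1) k in auto)
    then show "L1_estimator n (fhat n k)"
      unfolding L1_estimator_def fhat_def using f(1) T(1) k by auto
  qed
  let ?bad = "\<lambda>\<theta> n. {s \<in> space (sample_law K \<theta> n).
            (MAX k\<in>{1..K}. max \<bar>lhat n k s - weight \<theta> (\<tau> \<theta> k)\<bar>
               (L1_norm (\<lambda>x. fhat n k s x - comp \<theta> (\<tau> \<theta> k) x))) > \<epsilon> n}"
  have bad: "emeasure (sample_law K \<theta> n) (?bad \<theta> n) \<le> ennreal (\<beta> n)" if \<theta>: "\<theta> \<in> \<U>" "n \<ge> 1" for \<theta> n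
  proof -
    have S: "sample_law K \<theta> n = (\<Pi>\<^sub>M i\<in>{1..n}. p \<theta>)" by (simp add: sample_law_def p_def)
    interpret prob_space "\<Pi>\<^sub>M i\<in>{1..n}. p \<theta>" by (intro prob_space_PiM law \<theta>)
    obtain A where A: "A \<in> sets (\<Pi>\<^sub>M i\<in>{1..n}. p \<theta>)" "measure (\<Pi>\<^sub>M i\<in>{1..n}. p \<theta>) A \<le> \<beta> n"
      "\<And>s. s \<in> space (\<Pi>\<^sub>M i\<in>{1..n}. p \<theta>) - A \<Longrightarrow> loss (T n s) \<theta> < \<epsilon> n"
      using TA[OF \<theta>] by blast
    \<comment> \<open>Monotonicity of \<open>emeasure\<close> asks only that the larger set
      \<open>A\<close> be measurable.\<close>
    have "?bad \<theta> n \<subseteq> A"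
    proof
      fix s assume "s \<in> ?bad \<theta> n"
      then have "s \<in> space (\<Pi>\<^sub>M i\<in>{1..n}. p \<theta>)" "\<epsilon> n < loss (T n s) \<theta>"
        by (simp_all add: S loss_def lhat_def fhat_def)
      then show "s \<in> A" using A(3)[of s] by (metis DiffI less_asym)
    qed
    then have "emeasure (sample_law K \<theta> n) (?bad \<theta> n) \<le> emeasure (\<Pi>\<^sub>M i\<in>{1..n}. p \<theta>) A"
      unfolding S by (rule emeasure_mono[OF _ A(1)])
    also have "\<dots> \<le> ennreal (\<beta> n)"
      unfolding emeasure_eq_measure by (rule ennreal_leI[OF A(2)])
    finally show ?thesis .
  qed
  have "(\<lambda>n. SUP \<theta>\<in>\<U>. emeasure (sample_law K \<theta> n) (?bad \<theta> n)) \<longlonglongrightarrow> 0"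
  proof (rule tendsto_sandwich[OF _ _ tendsto_const])
    \<comment> \<open>The failure bound starts at \<open>n = 1\<close>; the empty sample does not
      affect the limit.\<close>
    show "\<forall>\<^sub>F n in sequentially. (SUP \<theta>\<in>\<U>. emeasure (sample_law K \<theta> n) (?bad \<theta> n)) \<le> ennreal (\<beta> n)"
      using eventually_ge_at_top[of 1] by eventually_elim (intro SUP_least bad)
    show "(\<lambda>n. ennreal (\<beta> n)) \<longlonglongrightarrow> 0"
      using tendsto_ennrealI[OF \<beta>] by simp
  qed auto
  with est \<tau> \<epsilon> show ?thesis
    by (intro exI[of _ lhat] exI[of _ fhat] exI[of _ "\<lambda>\<theta> n. \<tau> \<theta>"] exI[of _ \<epsilon>]) blast
qed

end
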